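(* Let $G$ and $H$ be vertex-disjoint graphs such that $\max\{\delta(G), \delta(H)\} \ge 2$. Then the 3-arc graph $X(G \vee H)$ of the join $G \vee H$ is Hamilton-connected.
   Context: All graphs are finite, undirected, without loops and without parallel edges. $\delta(G)$ denotes the minimum degree of $G$. Given vertex-disjoint graphs $G$ and $H$, the join $G\vee H$ is the graph with vertex set $V(G)\cup V(H)$ and edge set $E(G)\cup E(H)\cup\{\{u,v\}: u\in V(G), v\in V(H)\}$. An arc of a graph $\Gamma$ is an ordered pair $uv$ of adjacent vertices $u,v$ (so $uv \neq vu$, and each edge gives two arcs); $A(\Gamma)$ is the set of all arcs of $\Gamma$. A 3-arc of $\Gamma$ is a 4-tuple $(v,u,x,y)$ of vertices, possibly with $v=y$, such that both $(v,u,x)$ and $(u,x,y)$ are paths of $\Gamma$ (i.e. $v\ne x$, $u\neq y$, and $\{v,u\},\{u,x\},\{x,y\}$ are edges of $\Gamma$). The 3-arc graph $X(\Gamma)$ of $\Gamma$ is the graph with vertex set $A(\Gamma)$ in which the vertices corresponding to arcs $uv$ and $xy$ are adjacent if and only if $(v,u,x,y)$ is a 3-arc of $\Gamma$. A graph is Hamilton-connected if any two distinct vertices are connected by a Hamilton path, i.e. a path containing every vertex of the graph. *)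

theory Defs
  imports "Graph_Theory.Graph_Theory"
begin

(* An undirected graph is a "pair_graph": a finite, loop-free, symmetric relation "parcs" on a
   vertex set "pverts". Each edge {u,v} is thus represented by the two pairs (u,v) and (v,u),
   so "parcs G" is exactly the set A(G) of arcs, and the out-degree is the degree. *)

(* Only meaningful for a nonempty vertex set. *)
definition min_degree :: "'a pair_pre_digraph \<Rightarrow> nat" where
  "min_degree G = Min (out_degree G ` pverts G)"

definition graph_join :: "'a pair_pre_digraph \<Rightarrow> 'a pair_pre_digraph \<Rightarrow> 'a pair_pre_digraph" where
  "graph_join G H =
     \<lparr> pverts = pverts G \<union> pverts H,
       parcs = parcs G \<union> parcs H \<union> pverts G \<times> pverts H \<union> pverts H \<times> pverts G \<rparr>"

(* "vpath" requires all vertices to be distinct, so v, u, x and u, x, y are pairwise distinct,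
   while v = y is allowed. *)
definition three_arc :: "'a pair_pre_digraph \<Rightarrow> 'a \<Rightarrow> 'a \<Rightarrow> 'a \<Rightarrow> 'a \<Rightarrow> bool" where
  "three_arc G v u x y \<longleftrightarrow> vpath [v, u, x] G \<and> vpath [u, x, y] G"

definition three_arc_graph :: "'a pair_pre_digraph \<Rightarrow> ('a \<times> 'a) pair_pre_digraph" where
  "three_arc_graph G =
     \<lparr> pverts = parcs G,
       parcs = {((u, v), (x, y)) | u v x y.
                  (u, v) \<in> parcs G \<and> (x, y) \<in> parcs G \<and> three_arc G v u x y} \<rparr>"

lemma three_arc_graph_pair_graph:
  assumes "pair_graph G"
  shows "pair_graph (three_arc_graph G)"
proof -
  interpret pair_graph G by fact
  have sy: "(y, x) \<in> parcs G" if "(x, y) \<in> parcs G" for x y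
    using pair_sym_arcs that by (auto simp: symmetric_def dest: symD)
  have fin: "finite (parcs (three_arc_graph G))"
    by (rule finite_subset[of _ "parcs G \<times> parcs G"])
       (auto simp: three_arc_graph_def pair_finite_arcs)
  have "sym (parcs (three_arc_graph G))"
    by (rule symI) (auto simp: three_arc_graph_def three_arc_def vpath_def vwalk_def intro: sy)
  then show ?thesis
    using fin by unfold_locales
      (auto simp: three_arc_graph_def three_arc_def vpath_def vwalk_def symmetric_def pair_finite_arcs)
qed

lemma graph_join_pair_graph:
  assumes "pair_graph G" "pair_graph H" "pverts G \<inter> pverts H = {}"
  shows "pair_graph (graph_join G H)"
proof -
  interpret G: pair_graph G by fact
  interpret H: pair_graph H by fact
  have "sym (parcs G)" "sym (parcs H)"
    using G.pair_sym_arcs H.pair_sym_arcs by (auto simp: symmetric_def)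
  then have "sym (parcs (graph_join G H))"
    by (auto simp: graph_join_def sym_def)
  then show ?thesis
    using assms(3) G.pair_no_loops H.pair_no_loops
    by unfold_locales
      (auto simp: graph_join_def symmetric_def G.pair_finite_arcs H.pair_finite_arcs
         G.pair_finite_verts H.pair_finite_verts dest: G.wellformed' H.wellformed')
qed

definition hamilton_path :: "'a pair_pre_digraph \<Rightarrow> 'a list \<Rightarrow> bool" where
  "hamilton_path G p \<longleftrightarrow> vpath p G \<and> set p = pverts G"

definition hamilton_connected :: "'a pair_pre_digraph \<Rightarrow> bool" where
  "hamilton_connected G \<longleftrightarrow>
     (\<forall>a\<in>pverts G. \<forall>b\<in>pverts G. a \<noteq> b \<longrightarrow>
        (\<exists>p. hamilton_path G p \<and> hd p = a \<and> last p = b))"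

end

(* A Hamilton path of the 3-arc graph is a walk that visits each vertex u exactly d(u) times, where the
   visits are labelled by the neighbours of u and no visit is labelled by the vertex before or after
   it. Such a labelled walk on a subgraph survives enlarging the subgraph: a new edge ux, or a new
   vertex x with two edges, is absorbed by a detour from u to x and back, and the label x freed in
   this way fits every old visit of u. A similar exchange replaces the label of an end by a new neighbour.
   In the join, with hub h in H and an edge of G, a path of G on four vertices or a triangle yields a
   fan or a tetrahedron. Explicit walks on these small graphs provide a start for any two given
   arcs, and growing them to the whole join proves the claim. *)
theory Submission
  imports Defs
begin

subsection \<open>Surgery on trails of arcs\<close>

text \<open>A detour from \<open>u\<close> to \<open>x\<close> cannot visit \<open>x\<close> under
  the label \<open>u\<close>, since consecutive visits may not carry each other's vertex as a label.
  For a new edge, \<open>x\<close> is therefore visited under one of its old labels, whose former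
  visit takes over the label \<open>u\<close>; for a new vertex, under its second neighbour. This is
  why new vertices come with at least two edges, and why the arc sets in between are not symmetric.
  A detour rearranges the trail around two visits of \<open>u\<close> that are not its two ends;
  \<open>branching\<close> is the invariant that supplies them. The tail of an end stays fixed
  during growth, and its label can be exchanged only for an arc not yet traversed. So a starting
  graph must contain both tails, each with the wanted label or without the wanted arc. The factor
  without a degree bound may be a single vertex, hence one hub has to suffice, except when the two
  arcs have different tails in that factor.\<close>

definition follows :: "('a \<times> 'a) set \<Rightarrow> 'a \<times> 'a \<Rightarrow> 'a \<times> 'a \<Rightarrow> bool" where
  "follows E a b \<longleftrightarrow> (fst a, fst b) \<in> E \<and> snd a \<noteq> fst b \<and> fst a \<noteq> snd b"

text \<open>The arc set \<^term>\<open>A\<close> to be traversed is kept separate from the edge relation \<^term>\<open>E\<close>, because surgery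
  passes through arc sets that are not symmetric.\<close>
definition ham_trail ::
  "('a \<times> 'a) set \<Rightarrow> ('a \<times> 'a) set \<Rightarrow> 'a \<times> 'a \<Rightarrow> 'a \<times> 'a \<Rightarrow> ('a \<times> 'a) list \<Rightarrow> bool" where
  "ham_trail E A a b p \<longleftrightarrow>
     p \<noteq> [] \<and> hd p = a \<and> last p = b \<and> distinct p \<and> set p = A \<and> successively (follows E) p"

text \<open>A trail of the arcs \<^term>\<open>A\<close> whose ends have tails \<^term>\<open>s\<close> and \<^term>\<open>t\<close> visits \<^term>\<open>u\<close> at least twice, and
  not only at its ends.\<close>
definition branching :: "('a \<times> 'a) set \<Rightarrow> 'a \<Rightarrow> 'a \<Rightarrow> 'a \<Rightarrow> bool" where
  "branching A s t u \<longleftrightarrow>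
     (\<exists>v w. v \<noteq> w \<and> (u, v) \<in> A \<and> (u, w) \<in> A \<and>
        (s \<noteq> u \<or> t \<noteq> u \<or> (\<exists>z. z \<noteq> v \<and> z \<noteq> w \<and> (u, z) \<in> A)))"

definition linked :: "('a \<times> 'a) set \<Rightarrow> 'a \<times> 'a \<Rightarrow> 'a \<times> 'a \<Rightarrow> bool" where
  "linked E a b \<longleftrightarrow>
     sym E \<and> irrefl E \<and> (\<exists>p. ham_trail E E a b p) \<and> (\<forall>u\<in>Domain E. branching E (fst a) (fst b) u)"

lemma follows_commute: "sym E \<Longrightarrow> follows E a b \<longleftrightarrow> follows E b a"
  unfolding follows_def by (metis symD)

lemma follows_mono: "E \<subseteq> E' \<Longrightarrow> follows E a b \<Longrightarrow> follows E' a b"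
  by (auto simp: follows_def)

lemma successively_follows_mono:
  "E \<subseteq> E' \<Longrightarrow> successively (follows E) p \<Longrightarrow> successively (follows E') p"
  by (metis follows_mono successively_mono)

lemma successively_follows_rev:
  assumes "sym E"
  shows "successively (\<lambda>x y. follows E y x) p \<longleftrightarrow> successively (follows E) p"
  using follows_commute[OF assms] by (intro successively_cong) auto

lemma ham_trail_rev: "sym E \<Longrightarrow> ham_trail E A a b p \<Longrightarrow> ham_trail E A b a (rev p)"
  by (auto simp: ham_trail_def successively_follows_rev hd_rev last_rev)

lemma branching_commute: "branching A s t u \<longleftrightarrow> branching A t s u"
  unfolding branching_def by blast

lemma branching_mono: "A \<subseteq> A' \<Longrightarrow> branching A s t u \<Longrightarrow> branching A' s t u"
  unfolding branching_def by blast

lemma linked_commute: "linked E a b \<longleftrightarrow> linked E b a"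
  unfolding linked_def using ham_trail_rev branching_commute by metis

text \<open>If the two visits found are the two ends of the trail, then both tails are
  \<open>u\<close>, and the third arc from \<open>branching\<close> lies strictly inside; it
  replaces the second of them.\<close>

lemma two_visits:
  assumes "ham_trail E A a b p" "branching A (fst a) (fst b) u"
  obtains L v B v' R where "p = L @ (u, v) # B @ (u, v') # R" "L \<noteq> [] \<or> R \<noteq> []"
proof -
  have p: "set p = A" "hd p = a" "last p = b" "p \<noteq> []"
    using assms(1) by (auto simp: ham_trail_def)
  obtain v w where vw: "v \<noteq> w" "(u, v) \<in> A" "(u, w) \<in> A"
    and br: "fst a \<noteq> u \<or> fst b \<noteq> u \<or> (\<exists>z. z \<noteq> v \<and> z \<noteq> w \<and> (u, z) \<in> A)"
    using assms(2) unfolding branching_def by blast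
  have "\<exists>L B R c d. p = L @ (u, c) # B @ (u, d) # R \<and> {c, d} = {v, w}"
  proof -
    obtain L R where LR: "p = L @ (u, v) # R"
      using vw(2) p(1) by (metis split_list)
    then have "(u, w) \<in> set L \<or> (u, w) \<in> set R"
      using vw p(1) by auto
    then show ?thesis
    proof
      assume "(u, w) \<in> set L"
      then obtain L1 L2 where "L = L1 @ (u, w) # L2"
        by (metis split_list)
      then show ?thesis
        using LR by (intro exI[of _ L1] exI[of _ L2] exI[of _ R] exI[of _ w] exI[of _ v]) auto
    next
      assume "(u, w) \<in> set R"
      then obtain L1 L2 where "R = L1 @ (u, w) # L2"
        by (metis split_list)
      then show ?thesis
        using LR by (intro exI[of _ L] exI[of _ L1] exI[of _ L2] exI[of _ v] exI[of _ w]) auto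
    qed
  qed
  then obtain L B R c d where eq: "p = L @ (u, c) # B @ (u, d) # R" and cd: "{c, d} = {v, w}"
    by blast
  show thesis
  proof (cases "L \<noteq> [] \<or> R \<noteq> []")
    case True
    then show ?thesis using that eq by blast
  next
    case False
    then have "fst a = u" "fst b = u"
      using eq p by auto
    then obtain z where "z \<noteq> v" "z \<noteq> w" "(u, z) \<in> A"
      using br by blast
    moreover have "A = {(u, c), (u, d)} \<union> set B"
      using eq p(1) False by auto
    ultimately have "(u, z) \<in> set B"
      using cd by auto
    then obtain B1 B2 where "B = B1 @ (u, z) # B2"
      by (metis split_list)
    then show ?thesis
      using that[of "[]" c B1 z "B2 @ [(u, d)]"] eq False by auto
  qed
qed

lemma branching_cong:
  "(\<And>v. (u, v) \<in> A \<longleftrightarrow> (u, v) \<in> A') \<Longrightarrow> branching A s t u \<longleftrightarrow> branching A' s t u"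
  unfolding branching_def by blast

lemma branching_change_start: "branching A s t u \<Longrightarrow> s' \<noteq> u \<Longrightarrow> branching A s' t u"
  unfolding branching_def by blast

text \<open>Of two arcs at \<open>u\<close> at most one is an end, unless both ends have tail
  \<open>u\<close>, and then there is a third arc.\<close>

lemma branching_interior_arc:
  assumes "branching A (fst a) (fst b) u"
  obtains v where "(u, v) \<in> A" "(u, v) \<noteq> a" "(u, v) \<noteq> b"
proof -
  have "\<exists>v. (u, v) \<in> A \<and> (u, v) \<noteq> a \<and> (u, v) \<noteq> b"
    using assms unfolding branching_def by (cases a; cases b) auto
  then show thesis
    using that by blast
qed

text \<open>With two arcs \<open>uv\<close>, \<open>uv'\<close> on the trail, say \<open>L, uv, B, uv', R\<close> and \<open>R\<close> nonempty, the trail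
  \<open>L, uv, q, uv', rev B, ux, R\<close> makes a detour through \<open>q\<close>. The new adjacencies hold because no
  neighbour of \<open>u\<close> on the old trail is \<open>x\<close>, and \<open>uv'\<close> was already adjacent to the last arc of \<open>B\<close>.\<close>
lemma detour:
  assumes tr: "ham_trail E A a b p" and E: "sym E" "sym E'" "E \<subseteq> E'" "irrefl E"
    and new: "(u, x) \<in> E'" "(u, x) \<notin> E" "(u, x) \<notin> A"
    and br: "branching A (fst a) (fst b) u"
    and q: "q \<noteq> []" "fst (hd q) = x" "fst (last q) = x" "snd (hd q) \<noteq> u"
      "snd (last q) \<noteq> u"
      "distinct q" "set q \<inter> A = {}" "(u, x) \<notin> set q" "successively (follows E') q"
  obtains p' where "ham_trail E' (insert (u, x) (A \<union> set q)) a b p'"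
proof -
  have *: "\<exists>p'. ham_trail E' (insert (u, x) (A \<union> set q)) a b p'"
    if tr: "ham_trail E A a b p" and p: "p = L @ (u, v) # B @ (u, v') # R" and R: "R \<noteq> []"
    for a b p L v B v' R
  proof -
    \<comment> \<open>Two consecutive visits of \<open>u\<close> would put \<open>(u, u)\<close>
      into the irreflexive \<open>E\<close>.\<close>
    have B: "B \<noteq> []"
      using tr p E(4) by (auto simp: ham_trail_def successively_append_iff successively_Cons follows_def irrefl_def)
    define p' where "p' = L @ (u, v) # q @ (u, v') # rev B @ (u, x) # R"
    have s: "successively (follows E) p" and p0: "distinct p" "set p = A" "hd p = a" "last p = b"
      using tr by (auto simp: ham_trail_def)
    have s1: "successively (follows E') L" "successively (follows E') (rev B)"
       "successively (follows E') R"
      using s p E by (auto simp: successively_append_iff successively_Cons successively_follows_rev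
        successively_follows_mono[OF E(3)])
    have s2: "L \<noteq> [] \<Longrightarrow> follows E (last L) (u, v)" "follows E (u, v) (hd B)"
      "follows E (last B) (u, v')" "follows E (u, v') (hd R)"
      using s p R B by (auto simp: successively_append_iff successively_Cons)
    have sE: "\<And>y z. (y, z) \<in> E \<longleftrightarrow> (z, y) \<in> E"
      "\<And>y z. (y, z) \<in> E' \<longleftrightarrow> (z, y) \<in> E'"
    using E by (auto dest: symD)
  have ne: "v \<noteq> x" "v' \<noteq> x"
      using new(3) p p0 by auto
    have "L \<noteq> [] \<Longrightarrow> follows E' (last L) (u, v)" "follows E' (u, v') (last B)"
      using s2 follows_mono[OF E(3)] follows_commute[OF E(1)] by blast+
    moreover have "follows E' (u, v) (hd q)" "follows E' (last q) (u, v')"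
      using new(1) q ne sE(2)[of x u] by (simp_all add: follows_def)
    moreover have "follows E' (hd B) (u, x)" "follows E' (u, x) (hd R)"
      using s2(2,4) E(3) new(2) sE(2)[of "fst (hd B)" u] by (auto simp: follows_def)
    ultimately have s3: "L \<noteq> [] \<Longrightarrow> follows E' (last L) (u, v)"
      "follows E' (u, v) (hd q)"
      "follows E' (last q) (u, v')" "follows E' (u, v') (last B)" "follows E' (hd B) (u, x)"
      "follows E' (u, x) (hd R)"
      by blast+
    have "successively (follows E') p'"
      unfolding p'_def using s1 s3 R B q(1,9)
      by (auto simp: successively_append_iff successively_Cons hd_append last_rev hd_rev)
    moreover have "distinct p'"
      using p0(1) q(6,7,8) new(3) unfolding p'_def p p0(2)[symmetric] by auto
    moreover have "set p' = insert (u, x) (A \<union> set q)"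
      unfolding p'_def p p0(2)[symmetric] by auto
    moreover have "hd p' = a" "last p' = b" "p' \<noteq> []"
      using p0(3,4) R unfolding p'_def p by (auto simp: hd_append)
    ultimately show ?thesis
      unfolding ham_trail_def by blast
  qed
  obtain L v B v' R where p: "p = L @ (u, v) # B @ (u, v') # R" and LR: "L \<noteq> [] \<or> R \<noteq> []"
    using two_visits[OF tr br] .
  show thesis
  proof (cases "R = []")
    case False
    then show ?thesis using *[OF tr p] that by blast
  next
    case True
    then have "rev L \<noteq> []" using LR by auto
    moreover have "rev p = rev R @ (u, v') # rev B @ (u, v) # rev L"
      using p by simp
    ultimately obtain p' where "ham_trail E' (insert (u, x) (A \<union> set q)) b a p'"
      using *[OF ham_trail_rev[OF E(1) tr]] by blast
    then show ?thesis
      using ham_trail_rev[OF E(2)] that by blast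
  qed
qed

text \<open>The trail \<open>uw, B, uw', R\<close> turns into
  \<open>ux, rev B, uw, q, uw', R\<close>. Reversing \<open>B\<close> keeps \<open>uw\<close> next
  to \<open>hd B\<close>, and \<open>ux\<close> fits next to \<open>last B\<close>, an old neighbour
  of a visit of \<open>u\<close>.\<close>

lemma change_start:
  assumes tr: "ham_trail E A (u, w) b p" and E: "sym E" "sym E'" "E \<subseteq> E'" "irrefl E"
    and new: "(u, x) \<in> E'" "(u, x) \<notin> E" "(u, x) \<notin> A"
    and w': "(u, w') \<in> A" "w' \<noteq> w"
    and q: "q \<noteq> []" "fst (hd q) = x" "fst (last q) = x" "snd (hd q) \<noteq> u"
      "snd (last q) \<noteq> u"
      "distinct q" "set q \<inter> A = {}" "(u, x) \<notin> set q" "successively (follows E') q"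
  obtains p' where "ham_trail E' (insert (u, x) (A \<union> set q)) (u, x) b p'"
proof -
  have s: "successively (follows E) p" and p0: "distinct p" "set p = A" "hd p = (u, w)"
    "last p = b" "p \<noteq> []"
    using tr by (auto simp: ham_trail_def)
  obtain p1 where p1: "p = (u, w) # p1"
    using p0(3,5) by (cases p) auto
  then have "(u, w') \<in> set p1"
    using w' p0 by auto
  then obtain B R where p: "p = (u, w) # B @ (u, w') # R"
    using p1 by (metis split_list)
  have B: "B \<noteq> []"
    using s p E(4) by (auto simp: successively_append_iff successively_Cons follows_def irrefl_def)
  define p' where "p' = (u, x) # rev B @ (u, w) # q @ (u, w') # R"
  have s1: "successively (follows E') (rev B)" "successively (follows E') R"
    using s p E by (auto simp: successively_append_iff successively_Cons successively_follows_rev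
        successively_follows_mono[OF E(3)])
  have s2: "follows E (u, w) (hd B)" "follows E (last B) (u, w')"
    "R \<noteq> [] \<Longrightarrow> follows E (u, w') (hd R)"
    using s p B by (auto simp: successively_append_iff successively_Cons)
  have sE: "\<And>y z. (y, z) \<in> E \<longleftrightarrow> (z, y) \<in> E"
    "\<And>y z. (y, z) \<in> E' \<longleftrightarrow> (z, y) \<in> E'"
    using E by (auto dest: symD)
  have ne: "w \<noteq> x" "w' \<noteq> x"
    using new(3) p p0 by auto
  have "follows E' (hd B) (u, w)" "R \<noteq> [] \<Longrightarrow> follows E' (u, w') (hd R)"
    using s2 follows_mono[OF E(3)] follows_commute[OF E(1)] by blast+
  moreover have "follows E' (u, w) (hd q)" "follows E' (last q) (u, w')"
    using new(1) q ne sE(2)[of x u] by (simp_all add: follows_def)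
  moreover have "follows E' (u, x) (last B)"
    using s2(2) E(3) new(2) sE(1)[of "fst (last B)" u] by (auto simp: follows_def)
  ultimately have s3: "follows E' (u, x) (last B)" "follows E' (hd B) (u, w)"
     "follows E' (u, w) (hd q)" "follows E' (last q) (u, w')"
       "R \<noteq> [] \<Longrightarrow> follows E' (u, w') (hd R)"
    by blast+
  have "successively (follows E') p'"
    unfolding p'_def using s1 s3 B q(1,9)
    by (auto simp: successively_append_iff successively_Cons hd_append last_rev hd_rev)
  moreover have "distinct p'"
    using p0(1) q(6,7,8) new(3) unfolding p'_def p p0(2)[symmetric] by auto
  moreover have "set p' = insert (u, x) (A \<union> set q)"
    unfolding p'_def p p0(2)[symmetric] by auto
  moreover have "hd p' = (u, x)" "last p' = b" "p' \<noteq> []"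
    using p0(3,4) unfolding p'_def p by (auto simp: hd_append)
  ultimately show thesis
    using that unfolding ham_trail_def by blast
qed

text \<open>Both neighbours of the interior visit \<open>xy\<close> have tails adjacent to
  \<open>x\<close> in \<open>E\<close>, hence different from \<open>u\<close>, so the label
  \<open>u\<close> fits there. The freed arc \<open>xy\<close> can then serve as a detour.\<close>

lemma relabel:
  assumes tr: "ham_trail E A a b p" and E: "sym E" "(x, u) \<notin> E" and A: "(x, y) \<in> A"
    "(x, u) \<notin> A"
    and ne: "(x, y) \<noteq> a" "(x, y) \<noteq> b"
  obtains p' where "ham_trail E (insert (x, u) (A - {(x, y)})) a b p'"
proof -
  have p0: "successively (follows E) p" "distinct p" "set p = A" "hd p = a" "last p = b"
    using tr by (auto simp: ham_trail_def)
  obtain L R where p: "p = L @ (x, y) # R"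
    using A p0 by (metis split_list)
  have LR: "L \<noteq> []" "R \<noteq> []"
    using p ne p0 by auto
  have "successively (follows E) (L @ (x, u) # R)"
    using p0(1) E LR symD[OF E(1)]
    by (auto simp: p successively_append_iff successively_Cons follows_def)
  moreover have "distinct (L @ (x, u) # R)" "set (L @ (x, u) # R) = insert (x, u) (A - {(x, y)})"
    "hd (L @ (x, u) # R) = a" "last (L @ (x, u) # R) = b"
    using p0 p A LR by auto
  ultimately show thesis
    using that unfolding ham_trail_def by blast
qed

subsection \<open>Enlarging the graph\<close>

definition both :: "'a \<Rightarrow> 'a \<Rightarrow> ('a \<times> 'a) set" where
  "both u v = {(u, v), (v, u)}"

lemma sym_both [simp]: "sym (both u v)"
  by (auto simp: both_def sym_def)

lemma irrefl_Un_both [simp]: "irrefl (E \<union> both u v) \<longleftrightarrow> irrefl E \<and> u \<noteq> v"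
  by (auto simp: both_def irrefl_def)

lemma Domain_both [simp]: "Domain (both u v) = {u, v}"
  by (auto simp: both_def)

lemma linked_extendI:
  assumes "sym E'" "irrefl E'" "ham_trail E' E' a b p" "E \<subseteq> E'"
    "Domain E' \<subseteq> Domain E \<union> N"
    and "\<And>u. u \<in> Domain E \<Longrightarrow> branching E (fst a) (fst b) u"
    and "\<And>u. u \<in> N \<Longrightarrow> branching E' (fst a) (fst b) u"
  shows "linked E' a b"
  using assms branching_mono[OF assms(4)] unfolding linked_def by blast

lemma linkedE:
  assumes "linked E a b"
  obtains p where "sym E" "irrefl E" "ham_trail E E a b p" "a \<in> E" "b \<in> E"
    "\<And>u. u \<in> Domain E \<Longrightarrow> branching E (fst a) (fst b) u"
  using assms unfolding linked_def ham_trail_def by (metis hd_in_set last_in_set)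

lemma linked_arcs:
  assumes "linked E a b"
  shows "sym E" "irrefl E" "a \<in> E" "b \<in> E"
  using linkedE[OF assms] by blast+

lemma branching_new:
  "(u, v) \<in> A \<Longrightarrow> (u, w) \<in> A \<Longrightarrow> v \<noteq> w \<Longrightarrow> s \<noteq> u \<Longrightarrow> branching A s t u"
  unfolding branching_def by blast

lemma not_in_DomainD:
  assumes "sym E" "x \<notin> Domain E"
  shows "(x, z) \<notin> E" "(z, x) \<notin> E" "e \<in> E \<Longrightarrow> fst e \<noteq> x"
    "u \<in> Domain E \<Longrightarrow> u \<noteq> x"
proof -
  show "(x, z) \<notin> E" "(z, x) \<notin> E" "u \<in> Domain E \<Longrightarrow> u \<noteq> x"
    using assms by (auto dest: symD)
  show "e \<in> E \<Longrightarrow> fst e \<noteq> x"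
    using assms(2) by (cases e) auto
qed

lemma linked_add_edge:
  assumes l: "linked E a b" and ux: "u \<in> Domain E" "x \<in> Domain E" "u \<noteq> x"
    "(u, x) \<notin> E"
  shows "linked (E \<union> both u x) a b"
proof -
  let ?E = "E \<union> both u x"
  obtain p where E: "sym E" "irrefl E" and tr: "ham_trail E E a b p" and ab: "a \<in> E" "b \<in> E"
    and br: "\<And>u. u \<in> Domain E \<Longrightarrow> branching E (fst a) (fst b) u"
    using linkedE[OF l] by blast
  have xu: "(x, u) \<notin> E" using E ux symD by metis
  obtain y where y: "(x, y) \<in> E" "(x, y) \<noteq> a" "(x, y) \<noteq> b"
    using branching_interior_arc[OF br[OF ux(2)]] .
  \<comment> \<open>The arc set after the exchange: \<open>xu\<close> is already traversed, and
    \<open>xy\<close> is free to be the detour from \<open>u\<close>.\<close>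
  define A where "A = insert (x, u) (E - {(x, y)})"
  obtain p1 where p1: "ham_trail E A a b p1"
    using relabel[OF tr E(1) xu y(1) xu y(2,3)] unfolding A_def .
  have brA: "branching A (fst a) (fst b) u"
    using br[OF ux(1)] ux(3) by (subst branching_cong[of _ _ E]) (auto simp: A_def)
  have S: "sym ?E" "irrefl ?E"
    using E ux by (simp_all add: sym_Un)
  obtain p' where "ham_trail ?E (insert (u, x) (A \<union> set [(x, y)])) a b p'"
    by (rule detour[OF p1 E(1) S(1) _ E(2) _ _ _ brA, of x "[(x, y)]"])
      (use ux xu y in \<open>auto simp: A_def both_def\<close>)
  moreover have "insert (u, x) (A \<union> set [(x, y)]) = ?E"
    using y by (auto simp: A_def both_def)
  moreover have "Domain ?E \<subseteq> Domain E \<union> {}"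
    unfolding Domain_Un_eq Domain_both using ux by blast
  ultimately show ?thesis
    using S br by (intro linked_extendI[where E = E and N = "{}"]) auto
qed

text \<open>Each detour takes its label from the other edge: the one from \<open>u\<close> visits
  \<open>xv\<close>, the one from \<open>v\<close> visits \<open>xu\<close>. After the first,
  \<open>xv\<close> is traversed although \<open>vx\<close> is not yet an edge of
  \<open>?E1\<close>.\<close>

lemma linked_add_vertex:
  assumes l: "linked E a b" and u: "u \<in> Domain E" "v \<in> Domain E"
    "u \<noteq> v" and x: "x \<notin> Domain E"
  shows "linked (E \<union> both u x \<union> both v x) a b"
proof -
  let ?E = "E \<union> both u x \<union> both v x"
  obtain p where E: "sym E" "irrefl E" and tr: "ham_trail E E a b p" and ab: "a \<in> E" "b \<in> E"
    and br: "\<And>u. u \<in> Domain E \<Longrightarrow> branching E (fst a) (fst b) u"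
    using linkedE[OF l] by blast
  have x': "(x, z) \<notin> E" "(z, x) \<notin> E" for z
    using x symD[OF E(1), of z x] by auto
  have ne: "u \<noteq> x" "v \<noteq> x" "fst a \<noteq> x" "fst b \<noteq> x"
    using u x ab by (auto simp: Domain_fst)
  let ?E1 = "E \<union> both u x"
  have S: "sym ?E1" "irrefl ?E1" "sym ?E" "irrefl ?E"
    using E ne by (simp_all add: sym_Un)
  obtain p1 where p1: "ham_trail ?E1 (insert (u, x) (E \<union> set [(x, v)])) a b p1"
    by (rule detour[OF tr E(1) \<open>sym ?E1\<close> _ E(2) _ _ _ br[OF u(1)], of x "[(x, v)]"])
      (use u ne x' in \<open>auto simp: both_def\<close>)
  have brv: "branching (insert (u, x) (E \<union> set [(x, v)])) (fst a) (fst b) v"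
    by (rule branching_mono[OF _ br[OF u(2)]]) auto
  obtain p2 where "ham_trail ?E (insert (v, x) (insert (u, x) (E \<union> set [(x, v)]) \<union> set [(x, u)])) a b p2"
    by (rule detour[OF p1 S(1,3) _ S(2) _ _ _ brv, of x "[(x, u)]"])
      (use u ne x' in \<open>auto simp: both_def\<close>)
  moreover have "insert (v, x) (insert (u, x) (E \<union> set [(x, v)]) \<union> set [(x, u)]) = ?E"
    by (auto simp: both_def)
  moreover have "branching ?E (fst a) (fst b) x"
    using u ne by (intro branching_new[of _ u _ v]) (auto simp: both_def)
  moreover have "Domain ?E \<subseteq> Domain E \<union> {x}"
    unfolding Domain_Un_eq Domain_both using u by blast
  ultimately show ?thesis
    using S br by (intro linked_extendI[where E = E and N = "{x}"]) auto
qed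

text \<open>Serves to reach \<open>d\<close> when, of its known neighbours, only \<open>h\<close>
  has been reached. The vertices \<open>c\<close> and \<open>e\<close> are absorbed by single visits
  labelled \<open>d\<close>; a third detour picks up what is left.\<close>

lemma linked_add_path:
  assumes l: "linked E a b" and h: "h \<in> Domain E" and c: "c \<notin> Domain E"
    "d \<notin> Domain E" "e \<notin> Domain E"
    "distinct [c, d, e]"
  shows "linked (E \<union> both h c \<union> both h d \<union> both h e \<union> both c d \<union> both d e) a b"
proof -
  let ?E = "E \<union> both h c \<union> both h d \<union> both h e \<union> both c d \<union> both d e"
  obtain p where E: "sym E" "irrefl E" and tr: "ham_trail E E a b p" and ab: "a \<in> E" "b \<in> E"
    and br: "\<And>u. u \<in> Domain E \<Longrightarrow> branching E (fst a) (fst b) u"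
    using linkedE[OF l] by blast
  have new: "(x, z) \<notin> E" "(z, x) \<notin> E" "h \<noteq> x" "fst a \<noteq> x"
    "fst b \<noteq> x" if "x \<in> {c, d, e}" for x z
    using that c h ab by (metis insertE not_in_DomainD[OF E(1)] singletonD)+
  have n: "h \<noteq> c" "h \<noteq> d" "h \<noteq> e" "c \<noteq> d" "d \<noteq> e" "c \<noteq> e"
    using new(3) c(4) by auto
  let ?E1 = "E \<union> both h c" and ?A1 = "insert (h, c) (E \<union> set [(c, d)])"
  let ?E2 = "E \<union> both h c \<union> both h e" and ?A2 = "insert (h, e) (?A1 \<union> set [(e, d)])"
  \<comment> \<open>These are all new arcs with tail \<open>c\<close>, \<open>d\<close> or
    \<open>e\<close> except \<open>(c, d)\<close> and \<open>(e, d)\<close>, ordered as a trail from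
    \<open>d\<close> to \<open>d\<close>.\<close>
  let ?q = "[(d, e), (c, h), (d, h), (e, h), (d, c)]"
  have S: "sym ?E1" "irrefl ?E1" "sym ?E2" "irrefl ?E2" "sym ?E" "irrefl ?E"
    using E n by (simp_all add: sym_Un)
  obtain p1 where p1: "ham_trail ?E1 ?A1 a b p1"
    by (rule detour[OF tr E(1) S(1) _ E(2) _ _ _ br[OF h], of c "[(c, d)]"])
      (use n new(1,2) in \<open>auto simp: both_def\<close>)
  have brh: "branching A (fst a) (fst b) h" if "E \<subseteq> A" for A
    by (rule branching_mono[OF that br[OF h]])
  obtain p2 where p2: "ham_trail ?E2 ?A2 a b p2"
    by (rule detour[OF p1 S(1,3) _ S(2) _ _ _ brh, of e "[(e, d)]"])
      (use n new(1,2) in \<open>auto simp: both_def\<close>)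
  obtain p3 where "ham_trail ?E (insert (h, d) (?A2 \<union> set ?q)) a b p3"
    by (rule detour[OF p2 S(3,5) _ S(4) _ _ _ brh, of d ?q])
      (use n new(1,2) in \<open>auto simp: both_def follows_def\<close>)
  moreover have "insert (h, d) (?A2 \<union> set ?q) = ?E"
    by (auto simp: both_def)
  moreover have "branching ?E (fst a) (fst b) c" "branching ?E (fst a) (fst b) e"
    using n new(4,5) by (intro branching_new[of _ h _ d]; auto simp: both_def)+
  moreover have "branching ?E (fst a) (fst b) d"
    using n new(4,5) by (intro branching_new[of _ h _ c]) (auto simp: both_def)
  moreover have "Domain ?E \<subseteq> Domain E \<union> {c, d, e}"
    unfolding Domain_Un_eq Domain_both using h by blast
  ultimately show ?thesis
    using S br by (intro linked_extendI[where E = E and N = "{c, d, e}"]) auto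
qed

section \<open>Changing the label or the vertex of an end\<close>

lemma branching_two:
  assumes "branching A s t u"
  obtains w where "(u, w) \<in> A" "w \<noteq> v"
  using assms unfolding branching_def by blast

lemma branching_add:
  assumes "branching A s t u" "(u, v) \<notin> A" "A \<subseteq> A'" "(u, v) \<in> A'"
  shows "branching A' s' t' u"
proof -
  obtain y z where "y \<noteq> z" "(u, y) \<in> A" "(u, z) \<in> A"
    using assms(1) unfolding branching_def by blast
  then show ?thesis
    using assms(2-4) unfolding branching_def
    by (intro exI[of _ y] exI[of _ z]) auto
qed

text \<open>The exchange of \<open>linked_add_edge\<close>, with \<open>change_start\<close> in the
  place of \<open>detour\<close>.\<close>

lemma linked_change_start_old:
  assumes l: "linked E (u, w) b" and v: "u \<noteq> v" "(u, v) \<notin> E" "v \<in> Domain E"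
  shows "linked (E \<union> both u v) (u, v) b"
proof -
  let ?E = "E \<union> both u v"
  obtain p where E: "sym E" "irrefl E" and tr: "ham_trail E E (u, w) b p" and ab: "(u, w) \<in> E"
    "b \<in> E"
    and br: "\<And>z. z \<in> Domain E \<Longrightarrow> branching E u (fst b) z"
    using linkedE[OF l] by (metis fst_conv)
  have u: "u \<in> Domain E" using ab by auto
  have vu: "(v, u) \<notin> E" using E v symD by metis
  obtain y where y: "(v, y) \<in> E" "(v, y) \<noteq> (u, w)" "(v, y) \<noteq> b"
    using branching_interior_arc[of E "(u, w)" b v] br[OF v(3)] by auto
  define A where "A = insert (v, u) (E - {(v, y)})"
  obtain p1 where p1: "ham_trail E A (u, w) b p1"
    using relabel[OF tr E(1) vu y(1) vu y(2,3)] unfolding A_def .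
  obtain w' where w': "(u, w') \<in> E" "w' \<noteq> w"
    using branching_two br ab(1) by (metis DomainI)
  have S: "sym ?E" "irrefl ?E"
    using E v by (simp_all add: sym_Un)
  obtain p' where "ham_trail ?E (insert (u, v) (A \<union> set [(v, y)])) (u, v) b p'"
    by (rule change_start[OF p1 E(1) S(1) _ E(2) _ _ _ _ w'(2), of v "[(v, y)]"])
      (use v vu y w' in \<open>auto simp: A_def both_def\<close>)
  moreover have "insert (u, v) (A \<union> set [(v, y)]) = ?E"
    using y by (auto simp: A_def both_def)
  moreover have "Domain ?E \<subseteq> Domain E \<union> {}"
    unfolding Domain_Un_eq Domain_both using u v(3) by blast
  ultimately show ?thesis
    using S br by (intro linked_extendI[where E = E and N = "{}"]) auto
qed

lemma linked_change_start_new: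
  assumes l: "linked E (u, w) b" and x: "x \<notin> Domain E" and v: "v \<in> Domain E"
    "u \<noteq> v"
  shows "linked (E \<union> both u x \<union> both v x) (u, x) b"
proof -
  let ?E = "E \<union> both u x \<union> both v x"
  obtain p where E: "sym E" "irrefl E" and tr: "ham_trail E E (u, w) b p" and ab: "(u, w) \<in> E"
    "b \<in> E"
    and br: "\<And>z. z \<in> Domain E \<Longrightarrow> branching E u (fst b) z"
    using linkedE[OF l] by (metis fst_conv)
  have u: "u \<in> Domain E" using ab by auto
  have x': "(x, z) \<notin> E" "(z, x) \<notin> E" for z
    using x symD[OF E(1), of z x] by auto
  have ne: "u \<noteq> x" "v \<noteq> x" "fst b \<noteq> x"
    using u v x ab by (auto simp: Domain_fst)
  obtain w' where w': "(u, w') \<in> E" "w' \<noteq> w"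
    using branching_two br ab(1) by (metis DomainI)
  let ?E1 = "E \<union> both u x"
  have S: "sym ?E1" "irrefl ?E1" "sym ?E" "irrefl ?E"
    using E ne by (simp_all add: sym_Un)
  obtain p1 where p1: "ham_trail ?E1 (insert (u, x) (E \<union> set [(x, v)])) (u, x) b p1"
    by (rule change_start[OF tr E(1) S(1) _ E(2) _ _ _ w', of x "[(x, v)]"])
      (use u v ne x' in \<open>auto simp: both_def\<close>)
  have brv: "branching (insert (u, x) (E \<union> set [(x, v)])) (fst (u, x)) (fst b) v"
    using br[OF v(1)] by (auto elim: branching_mono[rotated])
  obtain p2 where "ham_trail ?E (insert (v, x) (insert (u, x) (E \<union> set [(x, v)]) \<union> set [(x, u)])) (u, x) b p2"
    by (rule detour[OF p1 S(1,3) _ S(2) _ _ _ brv, of x "[(x, u)]"])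
      (use u v ne x' in \<open>auto simp: both_def\<close>)
  moreover have "insert (v, x) (insert (u, x) (E \<union> set [(x, v)]) \<union> set [(x, u)]) = ?E"
    by (auto simp: both_def)
  moreover have "branching ?E u (fst b) x"
    using v ne by (intro branching_new[of _ u _ v]) (auto simp: both_def)
  moreover have "Domain ?E \<subseteq> Domain E \<union> {x}"
    unfolding Domain_Un_eq Domain_both using u v by blast
  ultimately show ?thesis
    using S br by (intro linked_extendI[where E = E and N = "{x}"]) auto
qed

text \<open>The visit \<open>(h, d)\<close> has to become the start, so the long trail from
  \<open>d\<close> to \<open>d\<close> comes first here, through \<open>change_start\<close>, and
  the detours to \<open>c\<close> and \<open>e\<close> follow.\<close>

lemma linked_change_start_path:
  assumes l: "linked E (h, w) b" and c: "c \<notin> Domain E" "d \<notin> Domain E"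
    "e \<notin> Domain E"
    "distinct [c, d, e]"
  shows "linked (E \<union> both h c \<union> both h d \<union> both h e \<union> both c d \<union> both d e) (h, d) b"
proof -
  let ?E = "E \<union> both h c \<union> both h d \<union> both h e \<union> both c d \<union> both d e"
  obtain p where E: "sym E" "irrefl E" and tr: "ham_trail E E (h, w) b p" and ab: "(h, w) \<in> E"
    "b \<in> E"
    and br: "\<And>z. z \<in> Domain E \<Longrightarrow> branching E h (fst b) z"
    using linkedE[OF l] by (metis fst_conv)
  have h: "h \<in> Domain E" using ab by auto
  have new: "(x, z) \<notin> E" "(z, x) \<notin> E" "h \<noteq> x"
    "fst b \<noteq> x" if "x \<in> {c, d, e}" for x z
    using that c h ab by (metis insertE not_in_DomainD[OF E(1)] singletonD)+
  have n: "h \<noteq> c" "h \<noteq> d" "h \<noteq> e" "c \<noteq> d" "d \<noteq> e" "c \<noteq> e"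
    using new(3) c(4) by auto
  obtain w' where w': "(h, w') \<in> E" "w' \<noteq> w"
    using branching_two br ab(1) by (metis DomainI)
  let ?q = "[(d, e), (c, h), (d, h), (e, h), (d, c)]"
  let ?E1 = "E \<union> both h d \<union> both c d \<union> both d e" and ?A1 = "insert (h, d) (E \<union> set ?q)"
  let ?E2 = "?E1 \<union> both h c" and ?A2 = "insert (h, c) (?A1 \<union> set [(c, d)])"
  have S: "sym ?E1" "irrefl ?E1" "sym ?E2" "irrefl ?E2" "sym ?E" "irrefl ?E"
    using E n by (simp_all add: sym_Un)
  obtain p1 where p1: "ham_trail ?E1 ?A1 (h, d) b p1"
    by (rule change_start[OF tr E(1) S(1) _ E(2) _ _ _ w', of d ?q])
      (use n new(1,2) in \<open>auto simp: both_def follows_def\<close>)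
  have brh: "branching A (fst (h, d)) (fst b) h" if "?A1 \<subseteq> A" for A
    using that by (intro branching_add[OF br[OF h] new(2)[of d h]]) auto
  obtain p2 where p2: "ham_trail ?E2 ?A2 (h, d) b p2"
    by (rule detour[OF p1 S(1,3) _ S(2) _ _ _ brh, of c "[(c, d)]"])
      (use n new(1,2) in \<open>auto simp: both_def\<close>)
  obtain p3 where "ham_trail ?E (insert (h, e) (?A2 \<union> set [(e, d)])) (h, d) b p3"
    by (rule detour[OF p2 S(3,5) _ S(4) _ _ _ brh, of e "[(e, d)]"])
      (use n new(1,2) in \<open>auto simp: both_def\<close>)
  moreover have "insert (h, e) (?A2 \<union> set [(e, d)]) = ?E"
    by (auto simp: both_def)
  moreover have "branching ?E h (fst b) c" "branching ?E h (fst b) e"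
    using n new(4) by (intro branching_new[of _ h _ d]; auto simp: both_def)+
  moreover have "branching ?E h (fst b) d"
    using n new(4) by (intro branching_new[of _ h _ c]) (auto simp: both_def)
  moreover have "Domain ?E \<subseteq> Domain E \<union> {c, d, e}"
    unfolding Domain_Un_eq Domain_both using h by blast
  ultimately show ?thesis
    using S br by (intro linked_extendI[where E = E and N = "{c, d, e}"]) auto
qed

text \<open>Moves an end to a new vertex. The new trail begins \<open>xu, vd, wc\<close>, where
  \<open>vd\<close> is freed by giving its interior visit the label \<open>x\<close>. The arcs
  \<open>ux\<close> and \<open>xv\<close> that are still missing come in by a detour from
  \<open>u\<close>.\<close>

lemma linked_new_start:
  assumes l: "linked E (w, c) b" and u: "u \<in> Domain E" "u \<noteq> v" and v: "(w, v) \<in> E"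
    "c \<noteq> v" "fst b \<noteq> v"
    and x: "x \<notin> Domain E"
  shows "linked (E \<union> both u x \<union> both v x) (x, u) b"
proof -
  let ?E = "E \<union> both u x \<union> both v x"
  obtain p where E: "sym E" "irrefl E" and tr: "ham_trail E E (w, c) b p" and ab: "(w, c) \<in> E"
    "b \<in> E"
    and br: "\<And>z. z \<in> Domain E \<Longrightarrow> branching E w (fst b) z"
    using linkedE[OF l] by (metis fst_conv)
  have v': "v \<in> Domain E" "(v, w) \<in> E"
    "w \<noteq> v" using v(1) symD[OF E(1)] E(2) by (auto simp: irrefl_def)
  have x': "(x, z) \<notin> E" "(z, x) \<notin> E" for z
    using x symD[OF E(1), of z x] by auto
  have ne: "u \<noteq> x" "v \<noteq> x" "w \<noteq> x" "fst b \<noteq> x"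
    using u v' ab not_in_DomainD[OF E(1) x] by auto
  \<comment> \<open>The visit \<open>vd\<close> will stand directly before \<open>wc\<close>, so its
    label may not be \<open>w\<close>.\<close>
  obtain d where d: "(v, d) \<in> E" "d \<noteq> w"
    using branching_two br v'(1) by metis
  define A where "A = insert (v, x) (E - {(v, d)})"
  have "(v, d) \<noteq> (w, c)" "(v, d) \<noteq> b"
    using v v' by auto
  then obtain p1 where p1: "ham_trail E A (w, c) b p1"
    using relabel[OF tr E(1) x'(2) d(1) x'(2)] unfolding A_def by blast
  let ?E1 = "E \<union> both v x"
  let ?A1 = "insert (x, u) (insert (v, x) E)"
  have S: "sym ?E1" "irrefl ?E1" "sym ?E" "irrefl ?E"
    using E ne by (simp_all add: sym_Un)
  have p2: "ham_trail ?E1 ?A1 (x, u) b ((x, u) # (v, d) # p1)"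
    using p1 u v v' d x' ne successively_follows_mono[of E ?E1 p1]
    by (auto simp: ham_trail_def successively_Cons follows_def A_def both_def)
  have bru: "branching ?A1 (fst (x, u)) (fst b) u"
    using br[OF u(1)] ne branching_mono[of E ?A1 x "fst b" u] by (auto intro: branching_change_start)
  obtain p2 where "ham_trail ?E (insert (u, x) (?A1 \<union> set [(x, v)])) (x, u) b p2"
    by (rule detour[OF p2 S(1,3) _ S(2) _ _ _ bru, of x "[(x, v)]"])
      (use u v ne x' in \<open>auto simp: both_def\<close>)
  moreover have "insert (u, x) (?A1 \<union> set [(x, v)]) = ?E"
    by (auto simp: both_def)
  moreover have "branching ?E x (fst b) z" if "z \<in> Domain ?E" for z
  proof (cases "z = x")
    case True
    then show ?thesis
      using u ne unfolding branching_commute[of _ x]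
      by (intro branching_new[of _ u _ v]) (auto simp: both_def)
  next
    case False
    then have "z \<in> Domain E"
      using that u(1) v'(1) unfolding Domain_Un_eq Domain_both by blast
    then show ?thesis
      using False br[of z] branching_mono[of E ?E x "fst b" z] by (auto intro: branching_change_start)
  qed
  ultimately show ?thesis
    using S unfolding linked_def by auto
qed

text \<open>The trails meet in \<open>sc, hz\<close>, where \<open>z \<noteq> s\<close> because
  \<open>hs\<close> cannot lie in both sets. No vertex is the tail of both ends of the joint trail,
  so two arcs at each vertex suffice for \<open>branching\<close>.\<close>

lemma linked_concat:
  assumes l1: "linked E a (s, c)" and l2: "linked F (h, z) b" and EF: "E \<inter> F = {}"
    and s: "(s, h) \<in> E" "c \<noteq> h" and ab: "fst a \<notin> Domain F"
      "fst b \<notin> Domain E"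
  shows "linked (E \<union> F) a b"
proof -
  obtain p where E: "sym E" "irrefl E" and p: "ham_trail E E a (s, c) p"
    and br1: "\<And>u. u \<in> Domain E \<Longrightarrow> branching E (fst a) s u"
    using linkedE[OF l1] by (metis fst_conv)
  obtain q where F: "sym F" "irrefl F" and q: "ham_trail F F (h, z) b q" and hz: "(h, z) \<in> F"
    and br2: "\<And>u. u \<in> Domain F \<Longrightarrow> branching F h (fst b) u"
    using linkedE[OF l2] by (metis fst_conv)
  have "z \<noteq> s"
    using s(1) hz EF symD[OF E(1)] by auto
  then have "ham_trail (E \<union> F) (E \<union> F) a b (p @ q)"
    using p q s EF successively_follows_mono[of E "E \<union> F" p] successively_follows_mono[of F "E \<union> F" q]
    by (auto simp: ham_trail_def successively_append_iff follows_def)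
  moreover have "branching (E \<union> F) (fst a) (fst b) u" if "u \<in> Domain (E \<union> F)" for u
  proof (cases "u \<in> Domain E")
    case True
    then have "fst b \<noteq> u" "branching (E \<union> F) (fst a) s u"
      using ab(2) branching_mono[OF Un_upper1 br1[OF True]] by blast+
    then show ?thesis
      by (metis branching_change_start branching_commute)
  next
    case False
    then have u: "u \<in> Domain F"
      using that by blast
    then have "fst a \<noteq> u" "branching (E \<union> F) h (fst b) u"
      using ab(1) branching_mono[OF Un_upper2 br2[OF u]] by blast+
    then show ?thesis
      by (metis branching_change_start)
  qed
  ultimately show ?thesis
    using E F unfolding linked_def by (auto simp: sym_Un irrefl_def)
qed

subsection \<open>Small graphs\<close>

text \<open>The trails below, on graphs with vertices \<open>0, 1, \<dots>\<close>, were found by computer search. In the fan, \<open>0\<close>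
  is the hub and \<open>1, 2, 3, 4\<close> is the path.\<close>

definition tour :: "(nat \<times> nat) list \<Rightarrow> bool" where
  "tour p \<longleftrightarrow> p \<noteq> [] \<and> distinct p \<and>
     (\<forall>(u, v)\<in>set p. u \<noteq> v \<and> (v, u) \<in> set p) \<and>
     successively (\<lambda>(u, v) (x, y). (u, x) \<in> set p \<and> v \<noteq> x \<and> u \<noteq> y) p \<and>
     (\<forall>(u, v)\<in>set p. length (filter (\<lambda>e. fst e = u) p) >
        (if fst (hd p) = u \<and> fst (last p) = u then 2 else 1))"

definition kite_tours :: "(nat \<times> nat) list list" where
  "kite_tours =
    [[(2,0), (1,0), (3,0), (1,2), (0,2), (1,3), (0,3), (2,1), (0,1), (3,1)]]"

text \<open>All tours start with \<open>(0,1)\<close>; their last arcs represent the eleven other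
  arcs up to exchanging 2 and 3.\<close>

definition tetrahedron_tours :: "(nat \<times> nat) list list" where
  "tetrahedron_tours =
    [[(0,1), (2,3), (0,3), (1,3), (2,0), (1,0), (3,2), (1,2), (3,0), (2,1), (3,1), (0,2)],
     [(0,1), (2,3), (0,3), (1,3), (0,2), (3,2), (1,2), (3,0), (2,1), (3,1), (2,0), (1,0)],
     [(0,1), (2,3), (0,3), (1,3), (0,2), (3,1), (2,1), (3,0), (2,0), (1,0), (3,2), (1,2)],
     [(0,1), (2,3), (0,3), (1,3), (0,2), (1,2), (3,2), (1,0), (3,0), (2,1), (3,1), (2,0)],
     [(0,1), (2,3), (0,3), (1,3), (0,2), (1,2), (3,2), (1,0), (3,0), (2,0), (3,1), (2,1)],
     [(0,1), (2,1), (3,1), (0,2), (3,2), (1,2), (0,3), (1,3), (2,0), (3,0), (1,0), (2,3)]]"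

text \<open>One tour for each of the 29 pairs of ends in \<open>fan_linked\<close>; these are the
  pairs that occur in the joins.\<close>

definition fan_tours :: "(nat \<times> nat) list list" where
  "fan_tours =
    [[(0,1), (4,3), (0,3), (1,2), (0,4), (2,3), (1,0), (2,0), (3,4), (2,1), (3,0), (4,0), (3,2), (0,2)],
     [(0,1), (4,3), (0,2), (1,2), (0,4), (3,2), (4,0), (3,0), (2,1), (3,4), (2,0), (1,0), (2,3), (0,3)],
     [(0,1), (4,3), (0,2), (1,2), (0,3), (2,3), (1,0), (2,0), (3,4), (2,1), (3,0), (4,0), (3,2), (0,4)],
     [(1,2), (0,2), (4,3), (0,3), (2,3), (1,0), (2,0), (3,0), (4,0), (3,2), (0,4), (3,4), (2,1), (0,1)],
     [(1,2), (0,3), (4,3), (0,1), (2,3), (1,0), (2,0), (3,0), (4,0), (3,2), (0,4), (2,1), (3,4), (0,2)],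
     [(1,2), (0,2), (4,3), (0,1), (3,2), (4,0), (3,0), (2,0), (1,0), (2,3), (0,4), (3,4), (2,1), (0,3)],
     [(1,2), (0,2), (4,3), (0,3), (2,3), (1,0), (2,0), (3,0), (4,0), (3,2), (0,1), (3,4), (2,1), (0,4)],
     [(1,0), (2,0), (3,4), (2,1), (3,0), (4,0), (3,2), (0,2), (1,2), (0,4), (2,3), (0,3), (4,3), (0,1)],
     [(1,0), (2,0), (3,4), (2,1), (3,0), (4,0), (3,2), (0,1), (2,3), (0,4), (1,2), (0,3), (4,3), (0,2)],
     [(1,0), (2,0), (3,4), (2,1), (3,0), (4,0), (3,2), (0,1), (2,3), (0,4), (1,2), (0,2), (4,3), (0,3)],
     [(1,0), (2,0), (3,4), (2,1), (3,0), (4,0), (3,2), (0,1), (2,3), (0,3), (4,3), (0,2), (1,2), (0,4)],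
     [(1,2), (0,2), (4,3), (0,3), (2,3), (1,0), (2,0), (3,0), (4,0), (3,2), (0,1), (3,4), (0,4), (2,1)],
     [(1,2), (0,2), (4,3), (0,3), (2,1), (0,1), (3,4), (0,4), (3,2), (4,0), (3,0), (2,0), (1,0), (2,3)],
     [(1,2), (0,2), (4,3), (0,3), (2,1), (3,0), (4,0), (3,2), (0,1), (3,4), (0,4), (2,3), (1,0), (2,0)],
     [(1,0), (2,0), (3,0), (4,0), (3,2), (0,2), (1,2), (0,3), (4,3), (0,1), (2,3), (0,4), (3,4), (2,1)],
     [(1,0), (2,0), (3,0), (4,0), (3,2), (0,2), (1,2), (0,3), (4,3), (0,1), (3,4), (2,1), (0,4), (2,3)],
     [(1,0), (2,3), (0,3), (1,2), (0,2), (4,3), (0,1), (3,2), (4,0), (3,0), (2,1), (0,4), (3,4), (2,0)],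
     [(2,1), (0,3), (1,2), (0,2), (3,4), (0,4), (2,3), (1,0), (2,0), (3,0), (4,0), (3,2), (0,1), (4,3)],
     [(2,1), (3,0), (2,0), (1,0), (2,3), (0,3), (1,2), (0,4), (3,4), (0,1), (4,3), (0,2), (3,2), (4,0)],
     [(2,3), (1,0), (2,0), (3,0), (4,0), (3,2), (0,1), (3,4), (0,2), (1,2), (0,4), (2,1), (0,3), (4,3)],
     [(2,3), (1,0), (2,0), (3,0), (2,1), (0,3), (1,2), (0,4), (3,4), (0,1), (4,3), (0,2), (3,2), (4,0)],
     [(2,0), (1,0), (2,3), (0,3), (1,2), (0,2), (3,4), (0,4), (2,1), (3,0), (4,0), (3,2), (0,1), (4,3)],
     [(2,0), (1,0), (2,3), (0,3), (1,2), (0,2), (4,3), (0,1), (3,2), (0,4), (3,4), (2,1), (3,0), (4,0)],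
     [(1,2), (0,2), (3,2), (4,0), (3,0), (2,0), (1,0), (2,3), (0,3), (2,1), (0,4), (3,4), (0,1), (4,3)],
     [(1,2), (0,2), (4,3), (0,3), (2,3), (1,0), (2,0), (3,0), (2,1), (0,1), (3,4), (0,4), (3,2), (4,0)],
     [(1,0), (2,0), (3,0), (4,0), (3,2), (0,2), (1,2), (0,3), (2,3), (0,4), (3,4), (2,1), (0,1), (4,3)],
     [(1,0), (2,0), (3,0), (2,1), (3,4), (0,1), (2,3), (0,3), (4,3), (0,2), (1,2), (0,4), (3,2), (4,0)],
     [(2,1), (0,3), (1,2), (0,2), (4,3), (0,1), (3,4), (0,4), (3,2), (4,0), (3,0), (2,0), (1,0), (2,3)],
     [(2,1), (3,0), (4,0), (3,2), (0,1), (4,3), (0,2), (3,4), (0,4), (1,2), (0,3), (2,3), (1,0), (2,0)]]"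

text \<open>The complete graph on four vertices without the edge \<open>cd\<close>, meant for two
  nonadjacent hubs \<open>c\<close> and \<open>d\<close> over an edge \<open>ab\<close> of the other
  factor.\<close>

definition kite :: "'a \<Rightarrow> 'a \<Rightarrow> 'a \<Rightarrow> 'a \<Rightarrow> ('a \<times> 'a) set" where
  "kite a b c d = both a b \<union> both a c \<union> both a d \<union> both b c \<union> both b d"

definition fan :: "'a \<Rightarrow> 'a \<Rightarrow> 'a \<Rightarrow> 'a \<Rightarrow> 'a \<Rightarrow> ('a \<times> 'a) set" where
  "fan h p q r s =
     both h p \<union> both h q \<union> both h r \<union> both h s \<union> both p q \<union> both q r \<union> both r s"

section \<open>Transporting the computed trails to arbitrary vertices\<close>

lemma branching_filter:
  assumes "distinct p" and
    "length (filter (\<lambda>e. fst e = u) p) > (if s = u \<and> t = u then 2 else 1)"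
  shows "branching (set p) s t u"
proof -
  define N where "N = {v. (u, v) \<in> set p}"
  have "set (filter (\<lambda>e. fst e = u) p) = Pair u ` N"
    by (auto simp: N_def)
  then have "length (filter (\<lambda>e. fst e = u) p) = card N"
    by (metis assms(1) card_image distinct_card distinct_filter inj_on_def prod.inject)
  then have c: "card N > (if s = u \<and> t = u then 2 else 1)"
    using assms(2) by simp
  then have "1 < card N"
    by (auto split: if_splits)
  then obtain v w where vw: "v \<in> N" "w \<in> N" "v \<noteq> w"
    by (metis card_le_Suc0_iff_eq One_nat_def card.infinite less_one not_less not_less_zero linorder_not_le)
  have "\<exists>z\<in>N. z \<noteq> v \<and> z \<noteq> w" if "s = u" "t = u"
  proof (rule ccontr)
    assume "\<not> ?thesis"
    then have "N \<subseteq> {v, w}"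
      by blast
    then show False
      using c that card_mono[of "{v, w}" N] vw(3) by auto
  qed
  then show ?thesis
    using vw unfolding branching_def N_def by blast
qed

lemma branching_image:
  assumes "branching A s t u" "f s = f u \<longleftrightarrow> s = u"
    "f t = f u \<longleftrightarrow> t = u"
    and inj: "\<And>v w. (u, v) \<in> A \<Longrightarrow> (u, w) \<in> A \<Longrightarrow> f v = f w \<longleftrightarrow> v = w"
  shows "branching (map_prod f f ` A) (f s) (f t) (f u)"
proof -
  obtain v w where vw: "v \<noteq> w" "(u, v) \<in> A" "(u, w) \<in> A"
    and br: "s \<noteq> u \<or> t \<noteq> u \<or> (\<exists>z. z \<noteq> v \<and> z \<noteq> w \<and> (u, z) \<in> A)"
    using assms(1) unfolding branching_def by blast
  then have "f v \<noteq> f w"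
    "f s \<noteq> f u \<or> f t \<noteq> f u \<or> (\<exists>z. z \<noteq> f v \<and> z \<noteq> f w \<and> (f u, z) \<in> map_prod f f ` A)"
    using assms(2,3) inj by (metis map_prod_imageI)+
  then show ?thesis
    unfolding branching_def using vw by (metis map_prod_imageI)
qed

text \<open>\<open>tour\<close> is an executable form of \<open>linked\<close> on the arcs of a
  list, with \<open>branching\<close> expressed by counting visits. An injective renaming of the
  vertices preserves every part of it.\<close>

lemma tour_linked:
  assumes p: "tour p" and f: "inj_on f (Domain (set p))"
  shows "linked (map_prod f f ` set p) (map_prod f f (hd p)) (map_prod f f (last p))"
proof -
  let ?f = "map_prod f f"
  have sy: "(v, u) \<in> set p" "u \<noteq> v" if "(u, v) \<in> set p" for u v
    using p that by (auto simp: tour_def)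
  have dom: "u \<in> Domain (set p)" "v \<in> Domain (set p)" if "(u, v) \<in> set p" for u v
    using sy(1)[OF that] that by blast+
  have eq: "f u = f v \<longleftrightarrow> u = v" if "u \<in> Domain (set p)"
    "v \<in> Domain (set p)" for u v
    using f that by (meson inj_on_eq_iff)
  have p0: "p \<noteq> []" "distinct p"
    using p by (auto simp: tour_def)
  have inj: "inj_on ?f (set p)"
    using dom eq by (intro inj_onI) (metis map_prod_simp old.prod.exhaust prod.inject)
  have "successively (\<lambda>a b. follows (?f ` set p) (?f a) (?f b)) p"
  proof (rule successively_mono)
    show "successively (\<lambda>(u, v) (x, y). (u, x) \<in> set p \<and> v \<noteq> x \<and> u \<noteq> y) p"
      using p by (simp add: tour_def)
  next
    fix a b
    assume "a \<in> set p" "b \<in> set p"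
      "(case a of (u, v) \<Rightarrow> \<lambda>(x, y). (u, x) \<in> set p \<and> v \<noteq> x \<and> u \<noteq> y) b"
    moreover obtain u v x y where "a = (u, v)" "b = (x, y)"
      by (meson surj_pair)
    ultimately show "follows (?f ` set p) (?f a) (?f b)"
      using eq[OF dom(2) dom(1), of u v x y] eq[OF dom(1) dom(2), of u v x y]
      by (auto simp: follows_def)
  qed
  then have "ham_trail (?f ` set p) (?f ` set p) (?f (hd p)) (?f (last p)) (map ?f p)"
    using p0 inj by (auto simp: ham_trail_def hd_map last_map distinct_map successively_map)
  moreover have "sym (?f ` set p)"
    using sy(1) by (force simp: sym_def)
  moreover have "irrefl (?f ` set p)"
    using sy(2) dom eq by (auto simp: irrefl_def)
  moreover have "branching (?f ` set p) (fst (?f (hd p))) (fst (?f (last p))) (f u)" if uv: "(u, v) \<in> set p" for u v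
  proof -
    have "length (filter (\<lambda>e. fst e = u) p) > (if fst (hd p) = u \<and> fst (last p) = u then 2 else 1)"
      using p uv by (auto simp: tour_def)
    then have "branching (set p) (fst (hd p)) (fst (last p)) u"
      by (rule branching_filter[OF p0(2)])
    moreover have "f (fst (hd p)) = f u \<longleftrightarrow> fst (hd p) = u"
      "f (fst (last p)) = f u \<longleftrightarrow> fst (last p) = u"
      using eq dom uv p0(1) by (metis hd_in_set last_in_set prod.collapse)+
    moreover have "f v = f w \<longleftrightarrow> v = w" if "(u, v) \<in> set p"
      "(u, w) \<in> set p" for v w
      using eq dom that by metis
    ultimately show ?thesis
      by (simp add: branching_image)
  qed
  ultimately show ?thesis
    unfolding linked_def by auto
qed

text \<open>The list \<open>xs\<close> supplies the names of the numbered vertices. All tours in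
  \<open>ps\<close> have the same arc set, so \<open>set (hd ps)\<close> stands for their common
  graph.\<close>

lemma tours_linked:
  assumes "\<forall>p\<in>set ps. tour p \<and> set p = set (hd ps)" "length xs = n" "distinct xs"
    and "\<forall>(u, v)\<in>set (hd ps). u < n"
    and "(a, b) \<in> set (map (\<lambda>p. (hd p, last p)) ps)"
  shows "linked (map_prod ((!) xs) ((!) xs) ` set (hd ps)) (map_prod ((!) xs) ((!) xs) a) (map_prod ((!) xs) ((!) xs) b)"
proof -
  obtain p where p: "p \<in> set ps" "a = hd p" "b = last p"
    using assms(5) by auto
  have "inj_on ((!) xs) (Domain (set (hd ps)))"
  proof (rule inj_onI)
    fix i j
    assume "i \<in> Domain (set (hd ps))" "j \<in> Domain (set (hd ps))" "xs ! i = xs ! j"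
    moreover from this have "i < n" "j < n"
      using assms(4) by blast+
    ultimately show "i = j"
      using assms(2,3) nth_eq_iff_index_eq by metis
  qed
  then show ?thesis
    using tour_linked[of p "(!) xs"] assms(1) p by auto
qed

lemma tours:
  "\<forall>p\<in>set kite_tours. tour p \<and> set p = set (hd kite_tours)"
  "\<forall>p\<in>set tetrahedron_tours. tour p \<and> set p = set (hd tetrahedron_tours)"
  "\<forall>p\<in>set fan_tours. tour p \<and> set p = set (hd fan_tours)"
  by code_simp+

lemma kite_linked:
  assumes "distinct [a, b, c, d]"
  shows "linked (kite a b c d) (c, a) (d, b)"
proof -
  have "map_prod ((!) [a, b, c, d]) ((!) [a, b, c, d]) ` set (hd kite_tours) = kite a b c d"
    by (auto simp: kite_tours_def kite_def both_def)
  then show ?thesis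
    using tours_linked[OF tours(1), of "[a, b, c, d]" 4 "(2,0)" "(3,1)"] assms
    by (simp add: kite_tours_def)
qed

definition complete :: "'a set \<Rightarrow> ('a \<times> 'a) set" where
  "complete V = V \<times> V - Id"

lemma tetrahedron_linked:
  assumes "card V = 4" "a \<in> complete V" "b \<in> complete V" "a \<noteq> b"
  shows "linked (complete V) a b"
proof -
  obtain u v where a: "a = (u, v)" "u \<in> V" "v \<in> V" "u \<noteq> v"
    using assms(2) by (auto simp: complete_def)
  have fin: "finite V"
    using assms(1) card.infinite by fastforce
  then have "card (V - {u, v}) = 2"
    using a assms(1) by (simp add: card_Diff_subset)
  then obtain w x where wx: "V - {u, v} = {w, x}" "w \<noteq> x"
    by (meson card_2_iff)
  \<comment> \<open>Stated for either order of the two remaining vertices, so that six tours cover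
    all eleven values of \<open>b\<close>.\<close>
  have *: "linked (complete V) (u, v) (u, y)" "linked (complete V) (u, v) (v, u)"
    "linked (complete V) (u, v) (v, y)" "linked (complete V) (u, v) (y, u)"
    "linked (complete V) (u, v) (y, v)" "linked (complete V) (u, v) (y, z)"
    if "V - {u, v} = {y, z}" "y \<noteq> z" for y z
  proof -
    have V: "V = {u, v, y, z}" and d: "distinct [u, v, y, z]"
      using that a by auto
    have "map_prod ((!) [u, v, y, z]) ((!) [u, v, y, z]) ` set (hd tetrahedron_tours) = complete V"
      using d by (auto simp: tetrahedron_tours_def complete_def V)
    then show "linked (complete V) (u, v) (u, y)" "linked (complete V) (u, v) (v, u)"
      "linked (complete V) (u, v) (v, y)" "linked (complete V) (u, v) (y, u)"
      "linked (complete V) (u, v) (y, v)" "linked (complete V) (u, v) (y, z)"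
      using tours_linked[OF tours(2), of "[u, v, y, z]" 4 "(0,1)" "(0,2)"]
        tours_linked[OF tours(2), of "[u, v, y, z]" 4 "(0,1)" "(1,0)"]
        tours_linked[OF tours(2), of "[u, v, y, z]" 4 "(0,1)" "(1,2)"]
        tours_linked[OF tours(2), of "[u, v, y, z]" 4 "(0,1)" "(2,0)"]
        tours_linked[OF tours(2), of "[u, v, y, z]" 4 "(0,1)" "(2,1)"]
        tours_linked[OF tours(2), of "[u, v, y, z]" 4 "(0,1)" "(2,3)"] d
      by (simp_all add: tetrahedron_tours_def)
  qed
  have "V = {u, v, w, x}"
    using wx(1) a(2,3) by blast
  then have "b \<in> {u, v, w, x} \<times> {u, v, w, x} - Id"
    using assms(3) unfolding complete_def by blast
  then show ?thesis
    using *[OF wx] *[of x w] wx a(1) assms(4) by (auto simp: insert_commute)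
qed

lemma fan_linked:
  assumes "distinct [h, p, q, r, s]"
  shows "x \<in> {q, h} \<Longrightarrow> y \<in> {p, q, r, s} \<Longrightarrow> linked (fan h p q r s) (p, x) (h, y)"
    and "y \<in> {q, r, s} \<Longrightarrow> linked (fan h p q r s) (h, p) (h, y)"
    and "x \<in> {q, h} \<Longrightarrow> y \<in> {p, r, h} \<Longrightarrow> linked (fan h p q r s) (p, x) (q, y)"
    and "x \<in> {p, r, h} \<Longrightarrow> y \<in> {r, h} \<Longrightarrow> linked (fan h p q r s) (q, x) (s, y)"
    and "x \<in> {q, h} \<Longrightarrow> y \<in> {r, h} \<Longrightarrow> linked (fan h p q r s) (p, x) (s, y)"
    and "y \<in> {r, h} \<Longrightarrow> linked (fan h p q r s) (q, p) (q, y)"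
proof -
  let ?f = "map_prod ((!) [h, p, q, r, s]) ((!) [h, p, q, r, s])"
  have E: "?f ` set (hd fan_tours) = fan h p q r s"
    by (simp add: fan_tours_def fan_def both_def) auto
  have "\<forall>(u, v)\<in>set (hd fan_tours). u < length [h, p, q, r, s]"
    by (simp add: fan_tours_def)
  note tour = tours_linked[OF tours(3) refl assms this]
  have "linked (fan h p q r s) (?f (hd t)) (?f (last t))" if "t \<in> set fan_tours" for t
    using tour[of "hd t" "last t"] that by (simp add: E)
  then have *: "\<forall>(a, b)\<in>set (map (\<lambda>t. (?f (hd t), ?f (last t))) fan_tours).
      linked (fan h p q r s) a b"
    by auto
  note ** = *[unfolded fan_tours_def, simplified]
  show "x \<in> {q, h} \<Longrightarrow> y \<in> {p, q, r, s} \<Longrightarrow> linked (fan h p q r s) (p, x) (h, y)"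
    and "y \<in> {q, r, s} \<Longrightarrow> linked (fan h p q r s) (h, p) (h, y)"
    and "x \<in> {q, h} \<Longrightarrow> y \<in> {p, r, h} \<Longrightarrow> linked (fan h p q r s) (p, x) (q, y)"
    and "x \<in> {p, r, h} \<Longrightarrow> y \<in> {r, h} \<Longrightarrow> linked (fan h p q r s) (q, x) (s, y)"
    and "x \<in> {q, h} \<Longrightarrow> y \<in> {r, h} \<Longrightarrow> linked (fan h p q r s) (p, x) (s, y)"
    and "y \<in> {r, h} \<Longrightarrow> linked (fan h p q r s) (q, p) (q, y)"
    using ** by auto
qed

subsection \<open>Joins\<close>

locale join =
  fixes A B :: "'a set" and EA EB :: "('a \<times> 'a) set"
  assumes finite: "finite A" "finite B"
    and disjoint: "A \<inter> B = {}"
    and A_ne: "A \<noteq> {}" and B_ne: "B \<noteq> {}"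
    and EA: "EA \<subseteq> A \<times> A" "sym EA" "irrefl EA"
    and EB: "EB \<subseteq> B \<times> B" "sym EB" "irrefl EB"
    and two_neighbours: "g \<in> A \<Longrightarrow> \<exists>x y. x \<noteq> y \<and> (g, x) \<in> EA \<and> (g, y) \<in> EA"
begin

definition J :: "('a \<times> 'a) set" where
  "J = EA \<union> EB \<union> A \<times> B \<union> B \<times> A"

lemma EA_commute: "(x, y) \<in> EA \<longleftrightarrow> (y, x) \<in> EA"
  using EA(2) by (auto dest: symD)

lemma J_commute: "(x, y) \<in> J \<longleftrightarrow> (y, x) \<in> J"
  using EA(2) EB(2) by (auto simp: J_def dest: symD)

lemma EA_D: "(x, y) \<in> EA \<Longrightarrow> x \<in> A \<and> y \<in> A \<and> x \<noteq> y \<and> (x, y) \<in> J"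
  using EA by (auto simp: J_def irrefl_def)

lemma J_irrefl: "(x, y) \<in> J \<Longrightarrow> x \<noteq> y"
  using EA EB disjoint by (auto simp: J_def irrefl_def)

lemma J_D: "(x, y) \<in> J \<Longrightarrow> x \<in> A \<union> B \<and> y \<in> A \<union> B"
  using EA EB by (auto simp: J_def)

lemma AB_J: "x \<in> A \<Longrightarrow> y \<in> B \<Longrightarrow> (x, y) \<in> J"
  "x \<in> A \<Longrightarrow> y \<in> B \<Longrightarrow> (y, x) \<in> J"
  "x \<in> A \<Longrightarrow> y \<in> B \<Longrightarrow> x \<noteq> y"
  using disjoint by (auto simp: J_def)

lemma J_in_A: "(x, y) \<in> J \<Longrightarrow> x \<in> A \<Longrightarrow> y \<in> A \<Longrightarrow> (x, y) \<in> EA"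
  using EA EB disjoint by (auto simp: J_def)

lemma finite_J: "finite J"
  by (rule finite_subset[of _ "(A \<union> B) \<times> (A \<union> B)"]) (use finite J_D in auto)

lemma both_J: "(u, v) \<in> J \<Longrightarrow> both u v \<subseteq> J"
  using J_commute by (auto simp: both_def)

lemma other_neighbour:
  assumes "g \<in> A"
  obtains y where "(g, y) \<in> EA" "y \<noteq> x"
  using two_neighbours[OF assms] by metis

section \<open>Growing a linked subgraph to the whole join\<close>

lemma grow:
  assumes l: "linked E a b" and E: "E \<subseteq> J" "E \<noteq> J" and h: "h \<in> B"
    "h \<in> Domain E"
  shows "\<exists>E'. linked E' a b \<and> E \<subset> E' \<and> E' \<subseteq> J"
proof -
  have witness: ?thesis if "linked E' a b" "E \<subset> E'" "E' \<subseteq> J" for E'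
    using that by blast
  obtain y z where yz: "(y, z) \<in> J" "(y, z) \<notin> E"
    using E by auto
  define D where "D = Domain E"
  \<comment> \<open>Missing vertices of \<open>A\<close> come before those of \<open>B\<close>,
    because a vertex of \<open>B\<close> is attached to two vertices of \<open>A\<close> already
    reached.\<close>
  have "y \<in> D \<and> z \<in> D \<or> (\<exists>x\<in>A. x \<notin> D) \<or> A \<subseteq> D \<and> (\<exists>x\<in>B. x \<notin> D)"
    using J_D[OF yz(1)] by blast
  then consider u x where "(u, x) \<in> J" "(u, x) \<notin> E" "u \<in> Domain E" "x \<in> Domain E"
    | x where "x \<in> A" "x \<notin> Domain E"
    | x where "A \<subseteq> Domain E" "x \<in> B" "x \<notin> Domain E"
    using yz unfolding D_def by metis
  then show ?thesis
  proof cases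
    case 1
    then have "linked (E \<union> both u x) a b"
      by (intro linked_add_edge[OF l]) (auto dest: J_irrefl)
    moreover have "E \<subset> E \<union> both u x"
      using 1 by (auto simp: both_def)
    ultimately show ?thesis
      using both_J[OF 1(1)] E by blast
  next
    case 2
    obtain c e where ce: "c \<noteq> e" "(x, c) \<in> EA" "(x, e) \<in> EA"
      using two_neighbours 2 by blast
    have J: "both h x \<subseteq> J" "both c x \<subseteq> J" "both e x \<subseteq> J"
      "both x e \<subseteq> J" "both h c \<subseteq> J" "both h e \<subseteq> J"
      using 2 ce h EA_D AB_J J_commute both_J by metis+
    have ne: "h \<noteq> c" "h \<noteq> e" "c \<noteq> x" "e \<noteq> x"
      using h ce EA_D AB_J(3) by blast+
    have E': "E \<subset> E \<union> both h x \<union> F" for F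
      using 2 by (auto simp: both_def)
    consider "c \<in> Domain E" | "e \<in> Domain E" | "c \<notin> Domain E" "e \<notin> Domain E"
      by blast
    then show ?thesis
    proof cases
      case 1
      show ?thesis
        by (rule witness[OF linked_add_vertex[OF l h(2) 1 ne(1) 2(2)] E']) (use J E in simp)
    next
      case 2
      show ?thesis
        by (rule witness[OF linked_add_vertex[OF l h(2) 2 ne(2) \<open>x \<notin> Domain E\<close>] E'])
          (use J E in simp)
    next
      \<comment> \<open>Neither of the two neighbours of \<open>x\<close> has been reached, so
        \<open>x\<close> enters together with both, hung onto the hub.\<close>
      case 3
      have "distinct [c, x, e]"
        using ce ne by auto
      then show ?thesis
        by (rule witness[OF linked_add_path[OF l h(2) 3(1) 2(2) 3(2)]])
          (use J E E'[of "both h c \<union> both h e \<union> both c x \<union> both x e"] in \<open>auto simp: Un_ac\<close>)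
    qed
  next
    case 3
    obtain g where g: "g \<in> A"
      using A_ne by blast
    then obtain g' where g': "(g, g') \<in> EA"
      using two_neighbours by blast
    have gg: "g' \<in> A" "g \<noteq> g'"
      using g' EA_D by auto
    have "linked (E \<union> both g x \<union> both g' x) a b"
      using 3 g gg by (intro linked_add_vertex[OF l]) auto
    moreover have "both g x \<subseteq> J" "both g' x \<subseteq> J"
      using 3 g gg AB_J both_J by metis+
    moreover have "E \<subset> E \<union> both g x \<union> both g' x"
      using 3 by (auto simp: both_def)
    ultimately show ?thesis
      using E by blast
  qed
qed

lemma linked_spanning:
  assumes "linked E a b" "E \<subseteq> J" "h \<in> B" "h \<in> Domain E"
  shows "linked J a b"
  using assms
proof (induction "card (J - E)" arbitrary: E rule: less_induct)
  case less
  show ?case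
  proof (cases "E = J")
    case True
    then show ?thesis using less.prems by simp
  next
    case False
    then obtain E' where E': "linked E' a b" "E \<subset> E'" "E' \<subseteq> J"
      using grow less.prems by blast
    then have "card (J - E') < card (J - E)"
      using finite_J less.prems(2) by (intro psubset_card_mono) blast+
    then show ?thesis
      using less.hyps[OF _ E'(1,3)] less.prems E'(2) by blast
  qed
qed

lemma linked_change_start_via:
  assumes l: "linked E (u, w) b" and E: "E \<subseteq> J" and v: "(u, v) \<in> J"
    "(u, v) \<notin> E"
    and v2: "v2 \<in> Domain E" "v2 \<noteq> u" "(v, v2) \<in> J"
  shows "\<exists>E'. linked E' (u, v) b \<and> E \<subseteq> E' \<and> E' \<subseteq> J \<and>
    E' \<subseteq> E \<union> both u v \<union> (if v \<in> Domain E then {} else both v2 v)"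
proof (cases "v \<in> Domain E")
  case True
  then have "linked (E \<union> both u v) (u, v) b"
    using l v J_irrefl by (intro linked_change_start_old) auto
  then show ?thesis
    using True E both_J[OF v(1)] by (intro exI[of _ "E \<union> both u v"]) auto
next
  case False
  then have "linked (E \<union> both u v \<union> both v2 v) (u, v) b"
    using l v2 by (intro linked_change_start_new) auto
  then show ?thesis
    using False E both_J[OF v(1)] both_J[of v2 v] v2(3) J_commute
    by (intro exI[of _ "E \<union> both u v \<union> both v2 v"]) auto
qed

lemma linked_change_start:
  assumes l: "linked E (u, w) b" and E: "E \<subseteq> J" and v: "(u, v) \<in> J"
    "(u, v) \<notin> E"
    and h: "h \<in> B" "h \<in> Domain E" and r: "r \<in> A" "r \<in> Domain E" "r \<noteq> u"
  shows "\<exists>E'. linked E' (u, v) b \<and> E \<subseteq> E' \<and> E' \<subseteq> J"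
proof -
  consider "v \<in> Domain E" | "v \<in> B" | "v \<in> A" "u \<in> A" | "v \<in> A"
    "v \<notin> Domain E" "u \<in> B"
    using J_D v by blast
  then show ?thesis
  proof cases
    case 1
    then have "linked (E \<union> both u v) (u, v) b"
      using l v J_irrefl by (intro linked_change_start_old) auto
    then show ?thesis
      using E both_J[OF v(1)] by (intro exI[of _ "E \<union> both u v"]) auto
  next
    case 2
    then show ?thesis
      using linked_change_start_via[OF l E v r(2,3)] AB_J r by blast
  next
    case 3
    then show ?thesis
      using linked_change_start_via[OF l E v h(2)] AB_J h by blast
  next
    \<comment> \<open>The hub \<open>h\<close> may be \<open>u\<close> itself, so the second
      neighbour of \<open>v\<close> is sought among its neighbours in \<open>A\<close>. If neither
      \<open>c\<close> nor \<open>e\<close> has been reached, the path \<open>c, v, e\<close> is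
      hung onto \<open>u\<close>.\<close>
    case 4
    obtain c e where ce: "c \<noteq> e" "(v, c) \<in> EA" "(v, e) \<in> EA"
      using two_neighbours 4 by blast
    have mem: "c \<in> A" "e \<in> A" "c \<noteq> v" "e \<noteq> v" "(v, c) \<in> J"
      "(v, e) \<in> J" "u \<noteq> c" "u \<noteq> e"
      using ce EA_D AB_J(3) 4(3) by blast+
    show ?thesis
    proof (cases "c \<in> Domain E \<or> e \<in> Domain E")
      case True
      then show ?thesis
        using linked_change_start_via[OF l E v] mem by metis
    next
      case False
      then have "linked (E \<union> both u c \<union> both u v \<union> both u e \<union> both c v \<union> both v e) (u, v) b"
        using l 4 ce mem by (intro linked_change_start_path) auto
      moreover have "both u c \<subseteq> J" "both u v \<subseteq> J" "both u e \<subseteq> J"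
        "both c v \<subseteq> J" "both v e \<subseteq> J"
        using mem 4 AB_J J_commute both_J by metis+
      ultimately show ?thesis
        using E by (intro exI[of _ "E \<union> both u c \<union> both u v \<union> both u e \<union> both c v \<union> both v e"] conjI) auto
    qed
  qed
qed

text \<open>Reduces each case to a small graph in which only the tails of the ends are right;
  \<open>w\<close> and \<open>z\<close> are the wanted labels or placeholders. The start is
  corrected first and with few new edges, then the other end with no such care, and finally the
  graph grows to \<open>J\<close>.\<close>

lemma linked_finish:
  assumes l: "linked E (u, w) (x, z)" and E: "E \<subseteq> J" and uv: "(u, v) \<in> J" and xy: "(x, y) \<in> J"
    and w: "w = v \<or> (u, v) \<notin> E" and z: "z = y \<or> (x, y) \<notin> E"
    and v2: "(u, v) \<notin> E \<Longrightarrow> \<exists>v2. v2 \<in> Domain E \<and> v2 \<noteq> u \<and> v2 \<noteq> x \<and> (v, v2) \<in> J"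
    and h: "h \<in> B" "h \<in> Domain E" and r: "r \<in> A" "r \<in> Domain E" "r \<noteq> x"
    and ne: "(x, y) \<noteq> (u, v)" "(x, y) \<noteq> (v, u) \<or> (u, v) \<in> E"
  shows "linked J (u, v) (x, y)"
proof -
  have x: "x \<in> Domain E"
    using linkedE[OF l] by (metis DomainI)
  obtain E1 where E1: "linked E1 (u, v) (x, z)" "E \<subseteq> E1" "E1 \<subseteq> J"
    "z = y \<or> (x, y) \<notin> E1"
  proof (cases "(u, v) \<in> E")
    case True
    then show ?thesis
      using that[of E] l E w z by auto
  next
    case False
    then obtain v2 where v2: "v2 \<in> Domain E" "v2 \<noteq> u" "v2 \<noteq> x" "(v, v2) \<in> J"
      using v2 by blast
    then obtain E1 where E1: "linked E1 (u, v) (x, z)" "E \<subseteq> E1" "E1 \<subseteq> J"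
      "E1 \<subseteq> E \<union> both u v \<union> (if v \<in> Domain E then {} else both v2 v)"
      using linked_change_start_via[OF l E uv False] by blast
    \<comment> \<open>The added edge at \<open>v2\<close> could contain \<open>(x, y)\<close> only
      for \<open>x = v2\<close> or for \<open>x = v\<close>; the latter fails because
      \<open>v\<close> is then new while \<open>x\<close> is in \<open>Domain E\<close>.\<close>
    have "(x, y) \<notin> E1" if "(x, y) \<notin> E"
      using E1(4) that ne False v2(3) x by (auto simp: both_def split: if_splits)
    then show ?thesis
      using that[of E1] E1 z by blast
  qed
  have D: "h \<in> Domain E1" "r \<in> Domain E1"
    using h r E1(2) by blast+
  show ?thesis
  proof (cases "z = y")
    case True
    then show ?thesis
      using E1 linked_spanning[OF _ E1(3) h(1) D(1)] by blast
  next
    case False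
    then obtain E2 where "linked E2 (x, y) (u, v)" "E1 \<subseteq> E2" "E2 \<subseteq> J"
      using linked_change_start[OF _ E1(3) xy _ h(1) D(1) r(1) D(2) r(3)] E1 linked_commute by metis
    then show ?thesis
      using linked_spanning[OF _ _ h(1)] D(1) linked_commute by (metis Domain_mono subsetD)
  qed
qed


section \<open>Fans and tetrahedra around a hub\<close>

definition hubbed :: "'a \<Rightarrow> ('a \<times> 'a) set \<Rightarrow> bool" where
  "hubbed h E \<longleftrightarrow> E \<subseteq> J \<and> sym E \<and> h \<in> B \<and> h \<in> Domain E \<and>
     (\<forall>z\<in>Domain E. z \<noteq> h \<longrightarrow> z \<in> A \<and> (z, h) \<in> E)"

text \<open>A fan or a tetrahedron with hub \<^term>\<open>h\<close>, starting with the edge \<^term>\<open>(p, q)\<close>, and what is needed of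
  it without distinguishing the two.\<close>
definition gadget :: "'a \<Rightarrow> 'a \<Rightarrow> 'a \<Rightarrow> 'a \<Rightarrow> ('a \<times> 'a) set \<Rightarrow> bool" where
  "gadget h p q r E \<longleftrightarrow> hubbed h E \<and> p \<in> A \<and> q \<in> A \<and>
     (p, q) \<in> E \<and> (q, r) \<in> E \<and> r \<in> A \<and> r \<noteq> p \<and>
     (\<forall>z\<in>Domain E. z \<in> {h, p, q} \<or> (q, z) \<in> EA \<or> (\<exists>t. t \<noteq> p \<and> (q, t) \<in> EA \<and> (t, z) \<in> EA)) \<and>
     (\<forall>w z. (p, w) \<in> E \<longrightarrow> (q, z) \<in> E \<longrightarrow> linked E (p, w) (q, z)) \<and>
     (\<forall>w z. (p, w) \<in> E \<longrightarrow> (h, z) \<in> E \<longrightarrow> linked E (p, w) (h, z)) \<and>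
     (\<forall>z. (h, z) \<in> E \<longrightarrow> z \<noteq> p \<longrightarrow> linked E (h, p) (h, z)) \<and>
     (\<forall>z. (q, z) \<in> E \<longrightarrow> z \<noteq> p \<longrightarrow> linked E (q, p) (q, z))"

lemma fan_J:
  assumes "h \<in> B" "(p, q) \<in> EA" "(q, r) \<in> EA" "(r, s) \<in> EA"
  shows "fan h p q r s \<subseteq> J"
proof -
  have "(h, p) \<in> J" "(h, q) \<in> J" "(h, r) \<in> J" "(h, s) \<in> J" "(p, q) \<in> J"
    "(q, r) \<in> J" "(r, s) \<in> J"
    using assms EA_D AB_J(2) by blast+
  then show ?thesis
    unfolding fan_def by (simp add: both_J)
qed

lemma Domain_fan: "Domain (fan h p q r s) = {h, p, q, r, s}"
  unfolding fan_def Domain_Un_eq Domain_both by auto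

text \<open>Let \<open>r\<close> be a second neighbour of \<open>q\<close>. Either
  \<open>p, q, r\<close> is a triangle, or the path is prolonged by a second neighbour
  \<open>s\<close> of \<open>r\<close>, and \<open>s \<noteq> p\<close> because \<open>pr\<close> is
  no edge. Both \<open>r\<close> and \<open>s\<close> are reached from \<open>q\<close> without
  passing \<open>p\<close>; this clause of \<open>gadget\<close> serves tails that are far apart in
  \<open>A\<close>.\<close>

lemma gadget_exists:
  assumes pq: "(p, q) \<in> EA" and h: "h \<in> B"
  obtains r E where "gadget h p q r E"
proof -
  have pqA: "p \<in> A" "q \<in> A" "p \<noteq> q"
    using pq EA_D by auto
  obtain r where r: "(q, r) \<in> EA" "r \<noteq> p"
    using other_neighbour pqA by blast
  have rA: "r \<in> A" "r \<noteq> q"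
    using r EA_D by auto
  have hne: "h \<noteq> p" "h \<noteq> q" "h \<noteq> r"
    using h pqA rA AB_J(3) by blast+
  show thesis
  proof (cases "(p, r) \<in> EA")
    case True
    let ?V = "{h, p, q, r}"
    have 4: "card ?V = 4"
      using hne pqA rA r by auto
    have J: "complete ?V \<subseteq> J"
      using pq r True h pqA rA EA_D AB_J EA_commute by (auto simp: complete_def)
    have D: "Domain (complete ?V) = ?V"
      using hne pqA by (auto simp: complete_def)
    have "sym (complete ?V)"
      by (auto simp: complete_def sym_def)
    then have "hubbed h (complete ?V)"
      using J D h pqA rA hne unfolding hubbed_def by (auto simp: complete_def)
    moreover have "(p, q) \<in> complete ?V" "(q, r) \<in> complete ?V"
      using pqA rA by (auto simp: complete_def)
    moreover have "\<forall>z\<in>?V. z \<in> {h, p, q} \<or> (q, z) \<in> EA \<or> (\<exists>t. t \<noteq> p \<and> (q, t) \<in> EA \<and> (t, z) \<in> EA)"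
      using r by blast
    moreover have "linked (complete ?V) (p, w) (q, z)"
      if "(p, w) \<in> complete ?V" "(q, z) \<in> complete ?V" for w z
      using that pqA by (intro tetrahedron_linked[OF 4]) simp_all
    moreover have "linked (complete ?V) (p, w) (h, z)"
      if "(p, w) \<in> complete ?V" "(h, z) \<in> complete ?V" for w z
      using that hne by (intro tetrahedron_linked[OF 4]) simp_all
    moreover have "linked (complete ?V) (h, p) (h, z)"
      if "(h, z) \<in> complete ?V" "z \<noteq> p" for z
      using that hne by (intro tetrahedron_linked[OF 4]) (simp_all add: complete_def)
    moreover have "linked (complete ?V) (q, p) (q, z)"
      if "(q, z) \<in> complete ?V" "z \<noteq> p" for z
      using that pqA by (intro tetrahedron_linked[OF 4]) (simp_all add: complete_def)
    ultimately have "gadget h p q r (complete ?V)"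
      unfolding gadget_def D using pqA rA r(2) by simp
    then show ?thesis
      using that by blast
  next
    case False
    obtain s where s: "(r, s) \<in> EA" "s \<noteq> q"
      using other_neighbour rA by blast
    have sA: "s \<in> A" "s \<noteq> r" "s \<noteq> p"
      using s EA_D False EA_commute by blast+
    have d: "distinct [h, p, q, r, s]"
      using hne pqA rA sA r s h AB_J(3) by auto
    have "sym (fan h p q r s)"
      by (simp add: fan_def sym_Un)
    then have hub: "hubbed h (fan h p q r s)"
      unfolding hubbed_def Domain_fan using fan_J[OF h pq r(1) s(1)] h pqA rA sA
      by (auto simp: fan_def both_def)
    have nb: "(p, x) \<in> fan h p q r s \<longleftrightarrow> x \<in> {q, h}"
       "(q, x) \<in> fan h p q r s \<longleftrightarrow> x \<in> {p, r, h}"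
         "(h, x) \<in> fan h p q r s \<longleftrightarrow> x \<in> {p, q, r, s}" for x
      using d by (auto simp: fan_def both_def)
    have "\<forall>z\<in>{h, p, q, r, s}. z \<in> {h, p, q} \<or> (q, z) \<in> EA \<or> (\<exists>t. t \<noteq> p \<and> (q, t) \<in> EA \<and> (t, z) \<in> EA)"
      using r s(1) by blast
    moreover have "(p, q) \<in> fan h p q r s" "(q, r) \<in> fan h p q r s"
      unfolding nb by simp_all
    moreover have "linked (fan h p q r s) (p, w) (q, z)"
      if "(p, w) \<in> fan h p q r s" "(q, z) \<in> fan h p q r s" for w z
      using that unfolding nb by (rule fan_linked(3)[OF d])
    moreover have "linked (fan h p q r s) (p, w) (h, z)"
      if "(p, w) \<in> fan h p q r s" "(h, z) \<in> fan h p q r s" for w z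
      using that unfolding nb by (rule fan_linked(1)[OF d])
    moreover have "linked (fan h p q r s) (h, p) (h, z)"
      if "(h, z) \<in> fan h p q r s" "z \<noteq> p" for z
      using that unfolding nb by (intro fan_linked(2)[OF d]) blast
    moreover have "linked (fan h p q r s) (q, p) (q, z)"
      if "(q, z) \<in> fan h p q r s" "z \<noteq> p" for z
      using that unfolding nb by (intro fan_linked(6)[OF d]) blast
    ultimately have "gadget h p q r (fan h p q r s)"
      unfolding gadget_def Domain_fan using hub pqA rA r(2) by simp
    then show ?thesis
      using that by blast
  qed
qed

lemma gadgetD:
  assumes "gadget h p q r E"
  shows "E \<subseteq> J" "sym E" "h \<in> B" "h \<in> Domain E" "(p, q) \<in> E" "(q, r) \<in> E"
    "r \<in> A" "r \<noteq> p" "r \<noteq> q"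
    "p \<in> A" "q \<in> A" "r \<in> Domain E" "p \<in> Domain E" "q \<in> Domain E"
      "(p, h) \<in> E" "(q, h) \<in> E" "(h, p) \<in> E" "(h, q) \<in> E"
    "h \<noteq> p" "h \<noteq> q" "h \<noteq> r" "p \<noteq> q"
      "\<And>z. z \<in> Domain E \<Longrightarrow> z \<noteq> h \<Longrightarrow> z \<in> A \<and> (z, h) \<in> E"
proof -
  have hub: "hubbed h E"
    using assms unfolding gadget_def by (elim conjE)
  show "E \<subseteq> J" and E: "sym E" and h: "h \<in> B" and hD: "h \<in> Domain E"
    using hub unfolding hubbed_def by simp_all
  show A: "z \<in> A \<and> (z, h) \<in> E" if "z \<in> Domain E" "z \<noteq> h" for z
    using hub that unfolding hubbed_def by (elim conjE) (drule (1) bspec; simp)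
  show pq: "(p, q) \<in> E" and qr: "(q, r) \<in> E" and r: "r \<in> A"
    "r \<noteq> p" and 4: "p \<in> A" "q \<in> A"
    using assms unfolding gadget_def by simp_all
  \<comment> \<open>Irreflexivity of \<open>E\<close> is not a clause of \<open>gadget\<close>; it
    comes from a linked pair.\<close>
  have 2: "linked E (p, q) (q, r)"
    using assms unfolding gadget_def by (elim conjE) simp
  have 3: "(q, p) \<in> E" "(r, q) \<in> E"
    using pq qr symD[OF E] by auto
  show "r \<noteq> q" "p \<noteq> q"
    using linked_arcs(2)[OF 2] pq qr by (auto simp: irrefl_def)
  show dom: "r \<in> Domain E" "p \<in> Domain E" "q \<in> Domain E"
    using pq qr 3(2) by auto
  show 5: "h \<noteq> p" "h \<noteq> q" "h \<noteq> r"
    using h r 4 AB_J(3) by metis+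
  show "(p, h) \<in> E" "(q, h) \<in> E"
    using A dom 5 by metis+
  then show "(h, p) \<in> E" "(h, q) \<in> E"
    using symD[OF E] by metis+
qed

lemma gadget_linked:
  assumes "gadget h p q r E"
  shows "(p, w) \<in> E \<Longrightarrow> (q, z) \<in> E \<Longrightarrow> linked E (p, w) (q, z)"
    and "(p, w) \<in> E \<Longrightarrow> (h, z) \<in> E \<Longrightarrow> linked E (p, w) (h, z)"
    and "(h, z) \<in> E \<Longrightarrow> z \<noteq> p \<Longrightarrow> linked E (h, p) (h, z)"
    and "(q, z) \<in> E \<Longrightarrow> z \<noteq> p \<Longrightarrow> linked E (q, p) (q, z)"
  using assms unfolding gadget_def by (elim conjE; simp)+

section \<open>The two given arcs, by the position of their tails\<close>

lemma same_tail_A: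
  assumes "(u, v) \<in> J" "(u, y) \<in> J" "u \<in> A" "v \<noteq> y"
  shows "linked J (u, v) (u, y)"
proof -
  have *: "linked J (u, v) (u, y)" if vy: "(u, v) \<in> EA" "(u, y) \<in> J" "v \<noteq> y" for v y
  proof -
    obtain h where "h \<in> B" using B_ne by blast
    \<comment> \<open>The edge is read as \<open>vu\<close>, which makes \<open>u\<close> the second
      vertex and allows two ends with tail \<open>u\<close>.\<close>
    then obtain r E where g: "gadget h v u r E"
      using gadget_exists vy EA_commute by blast
    note D = gadgetD[OF g]
    define z where "z = (if (u, y) \<in> E then y else h)"
    have "linked E (u, v) (u, z)"
      using gadget_linked[OF g] D vy unfolding z_def by simp
    moreover have "(u, v) \<in> E"
      using D(2,5) symD by metis
    ultimately show ?thesis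
      using D vy EA_D by (intro linked_finish[of E u v u z v y h r]) (auto simp: z_def split: if_splits)
  qed
  show ?thesis
  proof (cases "v \<in> A \<or> y \<in> A")
    case True
    then show ?thesis
      using *[of v y] *[of y v] assms J_in_A linked_commute by metis
  next
    case False
    then have vy: "v \<in> B" "y \<in> B"
      using assms J_D by blast+
    obtain p where "(p, u) \<in> EA"
      using two_neighbours assms(3) EA_commute by blast
    then obtain r E where g: "gadget v p u r E"
      using gadget_exists vy by blast
    note D = gadgetD[OF g]
    have "linked E (u, v) (u, p)"
      using gadget_linked[OF g] D by (subst linked_commute) simp
    moreover have "(u, y) \<notin> E"
      using D(2,23) vy AB_J(3) assms(4) symD by (metis DomainI)
    ultimately show ?thesis
      using D assms by (intro linked_finish[of E u v u p v y v r]) auto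
  qed
qed

lemma same_tail_B:
  assumes "(u, v) \<in> J" "(u, y) \<in> J" "u \<in> B" "v \<noteq> y"
  shows "linked J (u, v) (u, y)"
proof -
  have *: "linked J (u, v) (u, y)" if vy: "(u, v) \<in> J" "(u, y) \<in> J" "v \<in> A"
    "v \<noteq> y" for v y
  proof -
    obtain q where "(v, q) \<in> EA"
      using two_neighbours vy by blast
    then obtain r E where g: "gadget u v q r E"
      using gadget_exists assms(3) by blast
    note D = gadgetD[OF g]
    define z where "z = (if (u, y) \<in> E then y else q)"
    have "linked E (u, v) (u, z)"
      using gadget_linked[OF g] D vy unfolding z_def by simp
    then show ?thesis
      using D vy by (intro linked_finish[of E u v u z v y u r]) (auto simp: z_def split: if_splits)
  qed
  show ?thesis
  proof (cases "v \<in> A \<or> y \<in> A")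
    case True
    then show ?thesis
      using *[of v y] *[of y v] assms linked_commute by metis
  next
    case False
    then have vy: "v \<in> B" "y \<in> B"
      using assms J_D by blast+
    obtain p where p: "p \<in> A"
      using A_ne by blast
    then obtain q where "(p, q) \<in> EA"
      using two_neighbours by blast
    then obtain r E where g: "gadget u p q r E"
      using gadget_exists assms(3) by blast
    note D = gadgetD[OF g]
    have "linked E (u, p) (u, q)"
      using gadget_linked[OF g] D by simp
    moreover have "(u, z) \<notin> E" if "z \<in> B" "(u, z) \<in> J" for z
      using D(2,23) that J_irrefl AB_J(3) symD by (metis DomainI)
    moreover have "(v, p) \<in> J"
      using vy p AB_J by blast
    ultimately show ?thesis
      using D vy assms by (intro linked_finish[of E u p u q v y u p]) auto
  qed
qed

lemma tails_AB:
  assumes "(u, v) \<in> J" "(x, y) \<in> J" "u \<in> A" "x \<in> B"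
  shows "linked J (u, v) (x, y)"
proof -
  \<comment> \<open>With \<open>q = v\<close> whenever \<open>v\<close> is in \<open>A\<close>, the
    label of the start needs an exchange only for \<open>v\<close> in \<open>B\<close>, where
    \<open>r\<close> is the second neighbour.\<close>
  obtain q where q: "(u, q) \<in> EA" "v \<in> A \<Longrightarrow> q = v"
    using two_neighbours assms J_in_A by metis
  then obtain r E where g: "gadget x u q r E"
    using gadget_exists assms(4) by blast
  note D = gadgetD[OF g]
  define w where "w = (if (u, v) \<in> E then v else q)"
  define z where "z = (if (x, y) \<in> E then y else u)"
  have "linked E (u, w) (x, z)"
    using gadget_linked[OF g] D unfolding w_def z_def by simp
  moreover have "v \<in> B" "(v, r) \<in> J" if "(u, v) \<notin> E"
    using that D q assms J_D AB_J by blast+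
  ultimately show ?thesis
    using D assms by (intro linked_finish[of E u w x z v y x r]) (auto simp: w_def z_def split: if_splits)
qed

lemma tails_AA_adjacent:
  assumes "(u, v) \<in> J" "(x, y) \<in> J" "(u, x) \<in> EA"
  shows "linked J (u, v) (x, y)"
proof -
  obtain h where "h \<in> B" using B_ne by blast
  then obtain r E where g: "gadget h u x r E"
    using gadget_exists assms by blast
  note D = gadgetD[OF g]
  define w where "w = (if (u, v) \<in> E then v else x)"
  define z where "z = (if (x, y) \<in> E then y else r)"
  have l: "linked E (u, w) (x, z)"
    using gadget_linked[OF g] D unfolding w_def z_def by simp
  have "(v, h) \<in> J \<or> (v, r) \<in> J"
    using D(3,7) AB_J J_D[OF assms(1)] by blast
  then have "\<exists>v2. v2 \<in> Domain E \<and> v2 \<noteq> u \<and> v2 \<noteq> x \<and> (v, v2) \<in> J"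
    using D by metis
  then show ?thesis
    using D assms l by (intro linked_finish[of E u w x z v y h r]) (auto simp: w_def z_def split: if_splits)
qed

text \<open>Both tails act as hubs over one edge of \<open>A\<close>. If they are adjacent, the
  tetrahedron is taken because it contains \<open>ux\<close>; this settles the case that the given
  arcs are \<open>ux\<close> and \<open>xu\<close>.\<close>

lemma tails_BB:
  assumes "(u, v) \<in> J" "(x, y) \<in> J" "u \<in> B" "x \<in> B" "u \<noteq> x"
  shows "linked J (u, v) (x, y)"
proof (cases "(u, x) \<in> EB")
  case True
  obtain g where g: "g \<in> A" "v \<in> A \<Longrightarrow> g = v"
    using A_ne by blast
  then obtain g' where g': "(g, g') \<in> EA"
    using two_neighbours by blast
  have g'A: "g' \<in> A" "g \<noteq> g'"
    using g' EA_D by auto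
  let ?V = "{u, x, g, g'}"
  have ne: "u \<noteq> g" "u \<noteq> g'" "x \<noteq> g" "x \<noteq> g'"
    using assms g g'A AB_J(3) by blast+
  have 4: "card ?V = 4"
    using ne assms g'A by auto
  have "(u, x) \<in> J" "(g, g') \<in> J"
    using True g' by (auto simp: J_def)
  moreover from this have "(x, u) \<in> J" "(g', g) \<in> J"
    using J_commute by blast+
  ultimately have J: "complete ?V \<subseteq> J"
    using g(1) g'A assms AB_J by (auto simp: complete_def)
  define w where "w = (if (u, v) \<in> complete ?V then v else x)"
  define z where "z = (if (x, y) \<in> complete ?V then y else g)"
  have l: "linked (complete ?V) (u, w) (x, z)"
    using ne assms(5) by (intro tetrahedron_linked[OF 4]) (auto simp: complete_def w_def z_def)
  have "(v, g) \<in> J" if "(u, v) \<notin> complete ?V"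
    using that ne g AB_J J_D[OF assms(1)] by (auto simp: complete_def)
  moreover have "u \<in> Domain (complete ?V)" "g \<in> Domain (complete ?V)"
    using ne by (auto simp: complete_def)
  moreover have "(u, x) \<in> complete ?V"
    using assms by (auto simp: complete_def)
  ultimately show ?thesis
    using J l assms g ne by (intro linked_finish[of "complete ?V" u w x z v y u g])
      (auto simp: w_def z_def split: if_splits)
next
  case False
  have "\<exists>g g'. (g, g') \<in> EA \<and> (v \<in> A \<longrightarrow> v = g \<or> v \<noteq> g' \<and> (v, g) \<in> J) \<and> (y = g' \<or> y \<noteq> g \<and> y \<noteq> g')"
  proof -
    consider "v \<in> A" "v \<noteq> y" "(v, y) \<in> EA" | "v \<in> A" "v \<noteq> y"
      "(v, y) \<notin> EA" | "v \<in> A" "v = y"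
      | "v \<notin> A" "y \<in> A" | "v \<notin> A" "y \<notin> A"
      by blast
    then show ?thesis
    proof cases
      case 1
      then show ?thesis by blast
    next
      case 2
      then show ?thesis using two_neighbours by metis
    next
      \<comment> \<open>The edge \<open>gg'\<close> avoids the common label \<open>v = y\<close>,
        which is still adjacent to \<open>g\<close>.\<close>
      case 3
      obtain g where g: "(v, g) \<in> EA"
        using two_neighbours 3 by blast
      then obtain g' where "(g, g') \<in> EA" "g' \<noteq> v"
        using other_neighbour EA_D by metis
      then show ?thesis
        using 3 g EA_D by metis
    next
      case 4
      then obtain g where "(y, g) \<in> EA"
        using two_neighbours by blast
      then show ?thesis
        using 4 EA_commute by blast
    next
      case 5
      obtain g where "g \<in> A" using A_ne by blast
      then obtain g' where "(g, g') \<in> EA"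
        using two_neighbours by blast
      then show ?thesis
        using 5 EA_D by metis
    qed
  qed
  then obtain g g' where g: "(g, g') \<in> EA"
    "v \<in> A \<Longrightarrow> v = g \<or> v \<noteq> g' \<and> (v, g) \<in> J"
    "y = g' \<or> y \<noteq> g \<and> y \<noteq> g'"
    by blast
  have gA: "g \<in> A" "g' \<in> A" "g \<noteq> g'"
    using g EA_D by auto
  have ne: "u \<noteq> g" "u \<noteq> g'" "x \<noteq> g" "x \<noteq> g'"
    using assms gA AB_J(3) by blast+
  let ?E = "kite g g' u x"
  have l: "linked ?E (u, g) (x, g')"
    using ne gA assms by (intro kite_linked) auto
  have "both g g' \<subseteq> J" "both g u \<subseteq> J" "both g x \<subseteq> J"
    "both g' u \<subseteq> J" "both g' x \<subseteq> J"
    using gA assms AB_J g EA_D both_J by metis+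
  then have J: "?E \<subseteq> J"
    unfolding kite_def by simp
  have nb: "(u, i) \<in> ?E \<longleftrightarrow> i \<in> {g, g'}"
    "(x, i) \<in> ?E \<longleftrightarrow> i \<in> {g, g'}" for i
    using ne gA assms(5) by (auto simp: kite_def both_def)
  have D: "u \<in> Domain ?E" "g \<in> Domain ?E"
    by (auto simp: kite_def both_def)
  have "(v, g) \<in> J" if "v \<noteq> g"
    using g(2) that AB_J gA J_D[OF assms(1)] by blast
  moreover have "v \<noteq> g'"
    using g(2) gA by blast
  moreover have "v \<noteq> x"
    using assms False EA(1) disjoint by (auto simp: J_def)
  ultimately show ?thesis
    using J l assms g gA D ne by (intro linked_finish[of ?E u g x g' v y u g]) (auto simp: nb)
qed


lemma hubbedD:
  assumes "hubbed h E"
  shows "E \<subseteq> J" "sym E" "h \<in> B" "h \<in> Domain E"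
    "\<And>z. z \<in> Domain E \<Longrightarrow> z \<noteq> h \<Longrightarrow> z \<in> A \<and> (z, h) \<in> E"
proof -
  show "E \<subseteq> J" "sym E" "h \<in> B" "h \<in> Domain E"
    using assms unfolding hubbed_def by simp_all
  show "z \<in> A \<and> (z, h) \<in> E" if "z \<in> Domain E" "z \<noteq> h" for z
    using assms that unfolding hubbed_def by (elim conjE) (drule (1) bspec; simp)
qed

text \<open>The hub and \<open>z\<close> are two reached neighbours of \<open>q\<close>. As
  \<open>q\<close> is joined to the hub, the graph stays hubbed and the step can be
  repeated.\<close>

lemma hubbed_add_neighbour:
  assumes l: "linked E a b" and hub: "hubbed h E" and z: "z \<in> Domain E" "(q, z) \<in> EA"
  obtains E' where "linked E' a b" "hubbed h E'" "E \<subseteq> E'"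
    "Domain E' = insert q (Domain E)"
proof (cases "q \<in> Domain E")
  case True
  then show ?thesis
    using that[of E] l hub by (simp add: insert_absorb)
next
  case False
  note D = hubbedD[OF hub]
  have q: "q \<in> A" "z \<in> A" "(z, q) \<in> EA"
    using z EA_D EA_commute by auto
  have hz: "h \<noteq> z"
    using D(3) q AB_J(3) by blast
  let ?E = "E \<union> both h q \<union> both z q"
  have l': "linked ?E a b"
    using linked_add_vertex[OF l D(4) z(1) hz False] .
  have dom: "Domain ?E = insert q (Domain E)"
    unfolding Domain_Un_eq Domain_both using D(4) z(1) by blast
  have "?E \<subseteq> J"
    using D(1,3) q EA_D AB_J(2) both_J by simp
  moreover have "z' \<in> A \<and> (z', h) \<in> ?E" if "z' \<in> Domain ?E" "z' \<noteq> h" for z'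
    using that D(5) q unfolding dom by (auto simp: both_def)
  ultimately have "hubbed h ?E"
    using D(3) linked_arcs(1)[OF l'] dom D(4) unfolding hubbed_def by blast
  then show ?thesis
    using that[OF l' _ _ dom] by blast
qed

text \<open>A path of length at most three from \<^term>\<open>u\<close> to \<^term>\<open>x\<close> lies on a fan containing both. Otherwise
  take a gadget at each of the two vertices, with a common hub. If they share only the hub, their
  trails can be concatenated; if they overlap, the gadget at \<^term>\<open>u\<close> is enlarged until it reaches a
  neighbour of \<^term>\<open>x\<close> but not \<^term>\<open>x\<close>, which is then added as a new end.\<close>
lemma tails_AA_nonadjacent:
  assumes uv: "(u, v) \<in> J" and xy: "(x, y) \<in> J" and uA: "u \<in> A" and xA: "x \<in> A"
    and ux: "u \<noteq> x" "(u, x) \<notin> EA"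
  shows "linked J (u, v) (x, y)"
proof -
  have uxJ: "(u, x) \<notin> J"
    using ux uA xA J_in_A by blast
  then have vx: "v \<noteq> x"
    using uv by blast
  \<comment> \<open>Treats a fan whose path ends in \<open>x\<close> and has \<open>u\<close> among
    its first two vertices; the hub is the placeholder label at both ends.\<close>
  have fan_case: "linked J (u, v) (x, y)"
    if d: "distinct [h, p, q, r, s]" and h: "h \<in> B"
      and e: "(p, q) \<in> EA" "(q, r) \<in> EA" "(r, s) \<in> EA"
      and c: "u \<in> {p, q}" "s = x" "r \<noteq> u"
      and l: "\<And>w z. (u, w) \<in> fan h p q r s \<Longrightarrow> (x, z) \<in> fan h p q r s \<Longrightarrow>
        linked (fan h p q r s) (u, w) (x, z)" for h p q r s
  proof -
    let ?E = "fan h p q r s"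
    have J: "?E \<subseteq> J"
      by (rule fan_J[OF h e])
    have hE: "(u, h) \<in> ?E" "(x, h) \<in> ?E"
      using c by (auto simp: fan_def both_def)
    have D: "h \<in> Domain ?E" "r \<in> Domain ?E"
      unfolding Domain_fan by auto
    have rA: "r \<in> A" "r \<noteq> x"
      using e c EA_D by auto
    have hux: "h \<noteq> u" "h \<noteq> x"
      using h uA xA AB_J(3) by blast+
    define w where "w = (if (u, v) \<in> ?E then v else h)"
    define z where "z = (if (x, y) \<in> ?E then y else h)"
    have "linked ?E (u, w) (x, z)"
      using l hE by (simp add: w_def z_def)
    moreover have "(v, h) \<in> J \<or> (v, r) \<in> J"
      using h rA AB_J J_D[OF uv] by blast
    then have "\<exists>v2. v2 \<in> Domain ?E \<and> v2 \<noteq> u \<and> v2 \<noteq> x \<and> (v, v2) \<in> J"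
      using D hux rA c by metis
    ultimately show ?thesis
      using J h D rA uv xy vx ux
      by (intro linked_finish[of ?E u w x z v y h r]) (auto simp: w_def z_def)
  qed
  consider q where "(u, q) \<in> EA" "(q, x) \<in> EA"
    | q r where "(u, q) \<in> EA" "(q, r) \<in> EA" "(r, x) \<in> EA" "(u, r) \<notin> EA"
      "(q, x) \<notin> EA"
    | "\<And>q. (u, q) \<in> EA \<Longrightarrow> (q, x) \<notin> EA"
      "\<And>q r. (u, q) \<in> EA \<Longrightarrow> (q, r) \<in> EA \<Longrightarrow> (r, x) \<notin> EA"
    by metis
  then show ?thesis
  proof cases
    case 1
    \<comment> \<open>The path \<open>u, q, x\<close> is too short for a fan and is prolonged beyond
      \<open>u\<close>.\<close>
    obtain t where t: "(u, t) \<in> EA" "t \<noteq> q"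
      using other_neighbour[OF uA] by blast
    obtain h where h: "h \<in> B" using B_ne by blast
    have mem: "t \<in> A" "q \<in> A" "u \<noteq> t" "u \<noteq> q" "q \<noteq> x"
      "(t, u) \<in> EA" "t \<noteq> x"
      using t 1 EA_D EA_commute ux by blast+
    have d: "distinct [h, t, u, q, x]"
      using h mem t uA xA ux AB_J(3) by auto
    have nb: "(u, i) \<in> fan h t u q x \<longleftrightarrow> i \<in> {t, q, h}"
      "(x, i) \<in> fan h t u q x \<longleftrightarrow> i \<in> {q, h}" for i
      using d by (auto simp: fan_def both_def)
    show ?thesis
      by (rule fan_case[OF d h]) (use mem 1 fan_linked(4)[OF d] nb in auto)
  next
    case 2
    obtain h where h: "h \<in> B" using B_ne by blast
    have mem: "q \<in> A" "r \<in> A" "u \<noteq> q" "q \<noteq> r" "r \<noteq> x" "u \<noteq> r"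
      "q \<noteq> x"
      using 2 EA_D EA_commute ux by blast+
    have d: "distinct [h, u, q, r, x]"
      using h mem uA xA ux AB_J(3) by auto
    have nb: "(u, i) \<in> fan h u q r x \<longleftrightarrow> i \<in> {q, h}"
      "(x, i) \<in> fan h u q r x \<longleftrightarrow> i \<in> {r, h}" for i
      using d by (auto simp: fan_def both_def)
    show ?thesis
      by (rule fan_case[OF d h]) (use mem 2 fan_linked(5)[OF d] nb in auto)
  next
    case 3
    \<comment> \<open>Hub and \<open>q\<close> are chosen so that \<open>uv\<close> lies in the
      gadget at \<open>u\<close>, whichever factor contains \<open>v\<close>. Then only the label at
      \<open>x\<close> may need an exchange.\<close>
    obtain h where h: "h \<in> B" "v \<in> B \<Longrightarrow> h = v"
      using B_ne by blast
    obtain q where q: "(u, q) \<in> EA" "v \<in> A \<Longrightarrow> q = v"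
      using two_neighbours[OF uA] J_in_A[OF uv uA] by blast
    obtain q' where q': "(x, q') \<in> EA" "y \<in> A \<Longrightarrow> q' = y"
      using two_neighbours[OF xA] J_in_A[OF xy xA] by blast
    obtain r E where g: "gadget h u q r E"
      using gadget_exists[OF q(1) h(1)] .
    obtain r' F where g': "gadget h x q' r' F"
      using gadget_exists[OF q'(1) h(1)] .
    note D = gadgetD[OF g] and D' = gadgetD[OF g']
    have hub: "hubbed h E"
      using g unfolding gadget_def by simp
    have uvE: "(u, v) \<in> E"
      using J_D[OF uv] h(2) q(2) D(5,15) by blast
    have xE: "x \<notin> Domain E"
    proof
      assume "x \<in> Domain E"
      \<comment> \<open>Each of the last two alternatives gives a path of length at most three from
        \<open>u\<close> to \<open>x\<close>.\<close>
      then have "x \<in> {h, u, q} \<or> (q, x) \<in> EA \<or> (\<exists>t. t \<noteq> u \<and> (q, t) \<in> EA \<and> (t, x) \<in> EA)"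
        using g unfolding gadget_def by blast
      then show False
        using 3 q(1) ux xA D(3) AB_J(3) by blast
    qed
    have finish: "linked J (u, v) (x, y)"
      if l: "linked E' (u, v) (x, z)" and E': "E' \<subseteq> J"
        "E \<subseteq> E'" and z: "z = y \<or> (x, y) \<notin> E'" for E' z
    proof -
      have "h \<in> Domain E'" "q \<in> Domain E'" "(u, v) \<in> E'" "q \<noteq> x"
        using D(4,14) xE E' uvE by blast+
      then show ?thesis
        using l E' z uv xy h(1) D(11) ux by (intro linked_finish[of E' u v x z v y h q]) auto
    qed
    show ?thesis
    proof (cases "\<exists>g. g \<in> Domain E \<and> g \<in> Domain F \<and> g \<noteq> h")
      case False
      define z where "z = (if y \<in> A then y else h)"
      have "(x, z) \<in> F"
        using D'(5,15) q'(2) by (auto simp: z_def)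
      then have "linked F (h, x) (x, z)"
        using gadget_linked(2)[OF g'] D'(17) linked_commute by blast
      moreover have "linked E (u, v) (q, r)"
        using gadget_linked(1)[OF g uvE D(6)] .
      moreover have "E \<inter> F = {}"
      proof (rule ccontr)
        assume "E \<inter> F \<noteq> {}"
        then obtain i j where ij: "(i, j) \<in> E" "(i, j) \<in> F"
          by auto
        then have "(j, i) \<in> E" "(j, i) \<in> F"
          using D(2) D'(2) symD by metis+
        then have "i = h" "j = h"
          using ij False by blast+
        then show False
          using ij D(1) J_irrefl by blast
      qed
      \<comment> \<open>The joint is \<open>qr\<close> followed by \<open>hx\<close>, with
        \<open>qh\<close> an edge of \<open>E\<close>. As only the hub is shared, \<open>u\<close>
        lies outside \<open>F\<close>.\<close>
      ultimately have l: "linked (E \<union> F) (u, v) (x, z)"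
        using D(13,16,19,21) xE False by (intro linked_concat[of E "(u, v)" q r F h x "(x, z)"]) auto
      have "z = y \<or> (x, y) \<notin> E \<union> F"
      proof (cases "y \<in> A \<or> y = h")
        case True
        then show ?thesis by (auto simp: z_def)
      next
        case y: False
        have "y \<notin> Domain F"
          using y D'(23) by blast
        then have "(x, y) \<notin> F"
          using symD[OF D'(2)] by blast
        then show ?thesis
          using xE by blast
      qed
      then show ?thesis
        using finish[OF l] D(1) D'(1) by blast
    next
      case True
      then obtain g where gg: "g \<in> Domain E" "g \<in> Domain F" "g \<noteq> h"
        by blast
      \<comment> \<open>The shared vertex \<open>g\<close> is at most two steps from
        \<open>q'\<close> along a path avoiding \<open>x\<close>, so \<open>q'\<close> can be
        reached while \<open>x\<close> stays outside.\<close>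
      have reach: "\<exists>E'. linked E' a b \<and> hubbed h E' \<and> E \<subseteq> E' \<and> q' \<in> Domain E' \<and> x \<notin> Domain E'"
        if l: "linked E a b" for a b
      proof -
        have "g \<noteq> x"
          using gg xE by blast
        then consider "g = q'" | "(q', g) \<in> EA" | t where "t \<noteq> x" "(q', t) \<in> EA"
          "(t, g) \<in> EA"
          using g' gg unfolding gadget_def by blast
        then show ?thesis
        proof cases
          case 1
          then show ?thesis using l hub gg xE by blast
        next
          case 2
          obtain E' where E': "linked E' a b" "hubbed h E'" "E \<subseteq> E'"
            "Domain E' = insert q' (Domain E)"
            using hubbed_add_neighbour[OF l hub gg(1) 2] .
          then have "q' \<in> Domain E'" "x \<notin> Domain E'"
            using xE D'(22) unfolding E'(4) by simp_all
          then show ?thesis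
            using E' by blast
        next
          case 3
          obtain E1 where E1: "linked E1 a b" "hubbed h E1" "E \<subseteq> E1"
            "Domain E1 = insert t (Domain E)"
            using hubbed_add_neighbour[OF l hub gg(1) 3(3)] .
          then have "t \<in> Domain E1"
            by simp
          then obtain E' where E': "linked E' a b" "hubbed h E'" "E1 \<subseteq> E'"
            "Domain E' = insert q' (Domain E1)"
            using hubbed_add_neighbour[OF E1(1,2) _ 3(2)] by metis
          then have "q' \<in> Domain E'" "x \<notin> Domain E'"
            using xE D'(22) 3(1) unfolding E'(4) E1(4) by simp_all
          then show ?thesis
            using E' E1(3) by blast
        qed
      qed
      have bothJ: "both h x \<subseteq> J" "both q' x \<subseteq> J"
        using h(1) xA AB_J(2) both_J q'(1) EA_D J_commute by metis+
      show ?thesis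
      proof (cases "y \<in> A")
        case True
        obtain E' where E': "linked E' (u, v) (q, r)" "hubbed h E'" "E \<subseteq> E'"
          "q' \<in> Domain E'" "x \<notin> Domain E'"
          using reach[OF gadget_linked(1)[OF g uvE D(6)]] by blast
        have "linked E' (q, r) (u, v)"
          using E'(1) linked_commute by blast
        \<comment> \<open>The new trail begins with \<open>xq'\<close>, a visit of \<open>h\<close>,
          and \<open>qr\<close>.\<close>
        then have "linked (E' \<union> both q' x \<union> both h x) (x, q') (u, v)"
          using E' D(16,19,21) D'(20)
          by (intro linked_new_start[of E' q r "(u, v)" q' h x]) auto
        then show ?thesis
          using finish[of "E' \<union> both q' x \<union> both h x" q'] q'(2)[OF True] hubbedD(1)[OF E'(2)] E'(3) bothJ
            linked_commute by blast
      next
        case False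
        \<comment> \<open>Now \<open>y\<close> is in \<open>B\<close>, so the start is to be
          \<open>xh\<close>, with \<open>h\<close> a placeholder for \<open>y\<close>. The trail
          begins with \<open>xh\<close>, a visit of \<open>q'\<close>, and
          \<open>hq\<close>.\<close>
        obtain E' where E': "linked E' (u, v) (h, q)" "hubbed h E'" "E \<subseteq> E'"
          "q' \<in> Domain E'" "x \<notin> Domain E'"
          using reach[OF gadget_linked(2)[OF g uvE D(18)]] by blast
        have "(h, q') \<in> E'"
          using hubbedD(2,5)[OF E'(2)] E'(4) D'(20) symD by metis
        moreover have "q \<noteq> q'"
          using 3(1)[OF q(1)] q'(1) EA_commute by blast
        moreover have "u \<noteq> q'"
          using ux q'(1) EA_commute by blast
        moreover have "linked E' (h, q) (u, v)"
          using E'(1) linked_commute by blast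
        ultimately have l: "linked (E' \<union> both h x \<union> both q' x) (x, h) (u, v)"
          using E' D'(20) hubbedD(4)[OF E'(2)]
          by (intro linked_new_start[of E' h q "(u, v)" h q' x]) auto
        have "h = y \<or> (x, y) \<notin> E' \<union> both h x \<union> both q' x"
        proof (cases "y = h")
          case y: False
          have "y \<notin> Domain E'" "y \<noteq> q'" "y \<noteq> x"
            using y False hubbedD(5)[OF E'(2)] D'(11) xA by blast+
          then show ?thesis
            using E'(5) y by (auto simp: both_def)
        qed simp
        then show ?thesis
          using finish[of "E' \<union> both h x \<union> both q' x" h] l hubbedD(1)[OF E'(2)] E'(3) bothJ
            linked_commute by blast
      qed
    qed
  qed
qed

lemma linked_J:
  assumes "a \<in> J" "b \<in> J" "a \<noteq> b"
  shows "linked J a b"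
proof -
  obtain u v x y where ab: "a = (u, v)" "b = (x, y)"
    by (meson surj_pair)
  have "u \<in> A \<or> u \<in> B" "x \<in> A \<or> x \<in> B"
    using assms ab J_D by blast+
  then consider "u = x" "u \<in> A" | "u = x" "u \<in> B" | "u \<noteq> x" "u \<in> A"
    "x \<in> A" | "u \<in> A" "x \<in> B"
    | "u \<in> B" "x \<in> A" | "u \<noteq> x" "u \<in> B" "x \<in> B"
    by blast
  then show ?thesis
  proof cases
    case 1
    then show ?thesis using same_tail_A assms ab by auto
  next
    case 2
    then show ?thesis using same_tail_B assms ab by auto
  next
    case 3
    then show ?thesis
      using tails_AA_adjacent tails_AA_nonadjacent assms ab by blast
  next
    case 4
    then show ?thesis using tails_AB assms ab by auto
  next
    case 5
    then show ?thesis using tails_AB[of x y u v] assms ab linked_commute by blast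
  next
    case 6
    then show ?thesis using tails_BB assms ab by auto
  qed
qed

end

subsection \<open>The 3-arc graph of a join\<close>

lemma vwalk_arcs_subset_iff:
  "set (vwalk_arcs p) \<subseteq> S \<longleftrightarrow> successively (\<lambda>x y. (x, y) \<in> S) p"
  by (induction p rule: vwalk_arcs.induct) auto

text \<open>The visit of \<open>u\<close> labelled \<open>v\<close> is the arc \<open>uv\<close>,
  and \<open>follows\<close> is adjacency in the 3-arc graph; the remaining distinctness conditions
  hold because there are no loops.\<close>

lemma ham_trail_hamilton_path:
  assumes G: "pair_graph G" and p: "ham_trail (parcs G) (parcs G) a b p"
  shows "hamilton_path (three_arc_graph G) p"
proof -
  interpret pair_graph G by fact
  have irr: "x \<noteq> y" if "(x, y) \<in> parcs G" for x y
    using pair_no_loops[OF that] by auto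
  have sy: "(y, x) \<in> parcs G" if "(x, y) \<in> parcs G" for x y
    using pair_sym_arcs that by (auto simp: symmetric_def dest: symD)
  have wf: "x \<in> pverts G" "y \<in> pverts G" if "(x, y) \<in> parcs G" for x y
    using that by (auto dest: wellformed')
  have arc: "(a, b) \<in> parcs (three_arc_graph G)"
    if "a \<in> parcs G" "b \<in> parcs G" "follows (parcs G) a b" for a b
    using that irr sy wf
    by (cases a; cases b) (auto simp: follows_def three_arc_graph_def three_arc_def vpath_def vwalk_def)
  have "successively (\<lambda>a b. (a, b) \<in> parcs (three_arc_graph G)) p"
    using p arc by (auto simp: ham_trail_def elim!: successively_mono)
  then show ?thesis
    using p by (auto simp: hamilton_path_def vpath_def vwalk_def vwalk_arcs_subset_iff ham_trail_def
      three_arc_graph_def)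
qed

lemma hamilton_connected_join:
  assumes G: "pair_graph G" and H: "pair_graph H"
    and ne: "pverts G \<noteq> {}" "pverts H \<noteq> {}" "pverts G \<inter> pverts H = {}"
    and deg: "min_degree G \<ge> 2"
  shows "hamilton_connected (three_arc_graph (graph_join G H))"
proof -
  interpret G: pair_graph G by fact
  interpret H: pair_graph H by fact
  have "irrefl (parcs G)" "irrefl (parcs H)"
    using G.pair_no_loops H.pair_no_loops by (metis fst_conv irrefl_def snd_conv)+
  interpret join "pverts G" "pverts H" "parcs G" "parcs H"
  proof
    fix g
    assume g: "g \<in> pverts G"
    have "min_degree G \<le> out_degree G g"
      unfolding min_degree_def using g G.pair_finite_verts by (intro Min_le) auto
    then have "2 \<le> out_degree G g"
      using deg by simp
    then have "2 \<le> card {e \<in> parcs G. fst e = g}"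
      by (simp add: out_degree_def out_arcs_def)
    then have "\<not> card {e \<in> parcs G. fst e = g} \<le> Suc 0"
      by simp
    then obtain e f where "e \<in> parcs G" "f \<in> parcs G" "fst e = g" "fst f = g" "e \<noteq> f"
      using G.pair_finite_arcs by (auto simp: card_le_Suc0_iff_eq)
    then show "\<exists>x y. x \<noteq> y \<and> (g, x) \<in> parcs G \<and> (g, y) \<in> parcs G"
      by (metis prod.collapse)
  qed (use ne \<open>irrefl (parcs G)\<close> \<open>irrefl (parcs H)\<close> G.pair_sym_arcs H.pair_sym_arcs
      in \<open>auto simp: symmetric_def dest: G.wellformed' H.wellformed'\<close>)
  have J: "parcs (graph_join G H) = J"
    by (auto simp: graph_join_def J_def)
  have "\<exists>p. hamilton_path (three_arc_graph (graph_join G H)) p \<and> hd p = a \<and> last p = b"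
    if "a \<in> J" "b \<in> J" "a \<noteq> b" for a b
  proof -
    have "linked J a b"
      using linked_J[OF that] .
    then obtain p where p: "ham_trail J J a b p"
      unfolding linked_def by blast
    then show ?thesis
      using ham_trail_hamilton_path[OF graph_join_pair_graph[OF G H ne(3)], unfolded J, OF p]
      by (auto simp: ham_trail_def)
  qed
  then show ?thesis
    unfolding hamilton_connected_def by (simp add: three_arc_graph_def J)
qed

theorem corollary5:
  fixes G H :: "'a pair_pre_digraph"
  assumes "pair_graph G" and "pair_graph H"
    and "pverts G \<noteq> {}" and "pverts H \<noteq> {}"
    and "pverts G \<inter> pverts H = {}"
    and "max (min_degree G) (min_degree H) \<ge> 2"
  shows "hamilton_connected (three_arc_graph (graph_join G H))"
proof (cases "min_degree G \<ge> 2")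
  case True
  then show ?thesis
    using hamilton_connected_join assms by blast
next
  case False
  \<comment> \<open>The join is commutative, so the factor of minimum degree at least 2 may be put
    first.\<close>
  have "graph_join G H = graph_join H G"
    by (auto simp: graph_join_def)
  then show ?thesis
    using hamilton_connected_join[of H G] assms False by (auto simp: Int_commute max_def split: if_splits)
qed

end
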